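(* Let $\mathcal{R}$ be an integral domain of characteristic zero with identity, let $n\geqslant 1$ be an integer, and let $P\colon\mathcal{R}^n\to\mathcal{R}$ be a non-univariate polynomial function of degree $p\geqslant 2$. For $k\in\{p-1,p\}$, let $P_k$ be the homogeneous polynomial function obtained from $P$ by considering the terms of degree $k$ only. Then $P$ is bisymmetric if and only if $P_p$ is a monomial and $$P_p(\mathbf{x})=P(\mathbf{x}-b\mathbf{1})+b,$$ where $\mathbf{1}=(1,\ldots,1)$ and $b=P_{p-1}(\mathbf{1})/(p\,P_p(\mathbf{1}))$.
   Context: A polynomial function $P\colon\mathcal{R}^n\to\mathcal{R}$ is one induced by a polynomial in $\mathcal{R}[x_1,\ldots,x_n]$; since $\mathcal{R}$ is an infinite integral domain, polynomials and polynomial functions are identified. A monomial is a polynomial of the form $c\,x_1^{\gamma_1}\cdots x_n^{\gamma_n}$ with a single coefficient $c$ (nonzero here, since $P$ has degree $p$). The element $b$ lies in the fraction field $\mathrm{Frac}(\mathcal{R})$, and the displayed identity is an identity of polynomials over $\mathrm{Frac}(\mathcal{R})$. A function $f\colon\mathcal{R}^n\to\mathcal{R}$ is bisymmetric if the $n^2$-variable mapping $$(x_{11},\ldots,x_{1n};\ldots;x_{n1},\ldots,x_{nn})\mapsto f\big(f(x_{11},\ldots,x_{1n}),\ldots,f(x_{n1},\ldots,x_{nn})\big)$$ does not change if every $x_{ij}$ is replaced by $x_{ji}$. A polynomial function is univariate if it depends on at most one of its variables (equivalently, there is an index $j$ such that $\partial_{x_i}P=0$ for all $i\neq j$). *)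

theory Defs
  imports
    "HOL-Analysis.Finite_Cartesian_Product"
    "HOL-Library.Poly_Mapping"
    "HOL-Computational_Algebra.Fraction_Field"
    "HOL-Computational_Algebra.Polynomial_Factorial"
begin

text \<open>
  The variables are indexed by a finite type \<open>'n\<close>, so \<open>n = CARD('n) \<ge> 1\<close>. A polynomial maps
  exponent vectors to coefficients; the ring operations are those of
  \<^theory>\<open>HOL-Library.Poly_Mapping\<close>.
\<close>

type_synonym ('n, 'a) mpoly = "('n \<Rightarrow>\<^sub>0 nat) \<Rightarrow>\<^sub>0 'a"

definition const :: "'a::zero \<Rightarrow> ('n, 'a) mpoly" where
  "const c = Poly_Mapping.single 0 c"

definition vars :: "('n, 'a::comm_ring_1) mpoly ^ 'n" where
  "vars = (\<chi> i. Poly_Mapping.single (Poly_Mapping.single i 1) 1)"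

definition mdeg :: "('n::finite \<Rightarrow>\<^sub>0 nat) \<Rightarrow> nat" where
  "mdeg m = (\<Sum>i\<in>UNIV. Poly_Mapping.lookup m i)"

text \<open>By convention the zero polynomial has degree \<open>0\<close>.\<close>

definition total_degree :: "('n::finite, 'a::zero) mpoly \<Rightarrow> nat" where
  "total_degree P = Max (insert 0 (mdeg ` Poly_Mapping.keys P))"

definition hom_part :: "nat \<Rightarrow> ('n::finite, 'a::comm_monoid_add) mpoly \<Rightarrow> ('n, 'a) mpoly" where
  "hom_part k P =
     (\<Sum>m\<in>{m \<in> Poly_Mapping.keys P. mdeg m = k}. Poly_Mapping.single m (Poly_Mapping.lookup P m))"

definition is_monomial :: "('n, 'a::zero) mpoly \<Rightarrow> bool" where
  "is_monomial P \<longleftrightarrow> (\<exists>m c. c \<noteq> 0 \<and> P = Poly_Mapping.single m c)"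

definition poly_fun :: "('n::finite, 'a::comm_ring_1) mpoly \<Rightarrow> 'a ^ 'n \<Rightarrow> 'a" where
  "poly_fun P x =
     (\<Sum>m\<in>Poly_Mapping.keys P.
        Poly_Mapping.lookup P m * (\<Prod>i\<in>UNIV. (x $ i) ^ Poly_Mapping.lookup m i))"

text \<open>\<open>poly_subst P q\<close> is the polynomial \<open>P(q\<^sub>1, \<dots>, q\<^sub>n)\<close>.\<close>

definition poly_subst ::
    "('n::finite, 'a::comm_ring_1) mpoly \<Rightarrow> ('n, 'a) mpoly ^ 'n \<Rightarrow> ('n, 'a) mpoly" where
  "poly_subst P q =
     (\<Sum>m\<in>Poly_Mapping.keys P.
        const (Poly_Mapping.lookup P m) * (\<Prod>i\<in>UNIV. (q $ i) ^ Poly_Mapping.lookup m i))"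

definition fract_poly_ext :: "('n, 'a::idom) mpoly \<Rightarrow> ('n, 'a fract) mpoly" where
  "fract_poly_ext P = Poly_Mapping.map to_fract P"

definition bisymmetric :: "('a ^ 'n \<Rightarrow> 'a) \<Rightarrow> bool" where
  "bisymmetric f \<longleftrightarrow>
     (\<forall>x :: 'a ^ 'n ^ 'n. f (\<chi> i. f (\<chi> j. x $ i $ j)) = f (\<chi> i. f (\<chi> j. x $ j $ i)))"

definition depends_on :: "('a ^ 'n \<Rightarrow> 'b) \<Rightarrow> 'n \<Rightarrow> bool" where
  "depends_on f i \<longleftrightarrow> (\<exists>x y. (\<forall>j. j \<noteq> i \<longrightarrow> x $ j = y $ j) \<and> f x \<noteq> f y)"

definition univariate :: "('a ^ 'n \<Rightarrow> 'b) \<Rightarrow> bool" where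
  "univariate f \<longleftrightarrow> card {i. depends_on f i} \<le> 1"

end

theory Submission
  imports Defs
begin

text \<open>
  Let \<open>P\<close> be bisymmetric. Substituting \<open>x\<^sub>i\<^sub>j = t y\<^sub>i v\<^sub>j\<close> and comparing the coefficients of
  \<open>t ^ p\<^sup>2\<close> gives \<open>P\<^sub>p(v) ^ p P\<^sub>p(y ^ p) = P\<^sub>p(v ^ p) P\<^sub>p(y) ^ p\<close>; if \<open>P\<^sub>p\<close> had two terms, the second
  largest term of the right-hand side would exceed that of the left-hand side, so \<open>P\<^sub>p\<close> is a
  monomial \<open>c x ^ \<gamma>\<close>. Substituting \<open>x\<^sub>i\<^sub>j = y\<^sub>i\<close> shows that \<open>P\<close> commutes with its diagonal
  \<open>g(t) = P(t, \<dots>, t)\<close>, and by a degree argument at most one polynomial with a given leading form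
  commutes with \<open>g\<close>. If \<open>x ^ \<gamma>\<close> involves only \<open>x\<^sub>i\<close>, then \<open>g(x\<^sub>i)\<close> is such a polynomial and \<open>P\<close> is
  univariate. Otherwise put \<open>x\<close> for one variable of \<open>x ^ \<gamma>\<close> and \<open>y\<close> for all the others: the leading
  coefficient \<open>h(x)\<close> in \<open>y\<close> is not constant, and \<open>h(g)\<close> is a constant multiple of \<open>h ^ p\<close>. This
  forces \<open>g = c (t + \<beta>) ^ p - \<beta>\<close>, which commutes with \<open>c \<Prod> (x\<^sub>i + \<beta>) ^ \<gamma>\<^sub>i - \<beta>\<close>, so this is \<open>P\<close>.

  All identities are only needed at points with natural number coordinates, so they pass freely
  between the domain and its fraction field.
\<close>

section \<open>Composition of univariate polynomials\<close>

lemma to_fract_of_nat [simp]: "to_fract (of_nat k) = of_nat k"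
  by (induction k) simp_all

instance fract :: ("{idom, ring_char_0}") ring_char_0
proof
  show "inj (of_nat :: nat \<Rightarrow> 'a fract)"
    by (rule injI) (metis to_fract_of_nat to_fract_eq_iff of_nat_eq_iff)
qed

instance fract :: ("{idom, ring_char_0}") field_char_0 ..

text \<open>A nonzero polynomial over a domain has finitely many roots, while in characteristic zero
  the positive integers are infinitely many distinct elements.\<close>

lemma poly_eqI_of_nat:
  fixes p q :: "'a::{idom, ring_char_0} poly"
  assumes "\<And>k::nat. k > 0 \<Longrightarrow> poly p (of_nat k) = poly q (of_nat k)"
  shows "p = q"
proof (rule ccontr)
  assume "p \<noteq> q"
  hence "finite {x. poly (p - q) x = 0}" by (intro poly_roots_finite) simp
  moreover have "of_nat ` {0::nat<..} \<subseteq> {x. poly (p - q) x = 0}"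
    using assms by auto
  ultimately have "finite ((of_nat :: nat \<Rightarrow> 'a) ` {0<..})" by (rule rev_finite_subset)
  hence "finite {0::nat<..}" by (rule finite_imageD) (simp add: inj_on_def)
  thus False by (simp add: infinite_Ioi)
qed

section \<open>Top coefficients of products, powers and compositions\<close>

text \<open>Working at an upper bound of the degree, where the coefficient may be zero, avoids
  asking whether leading coefficients vanish.\<close>

lemma coeff_mult_degree_bound:
  fixes p q :: "'a::comm_semiring_0 poly"
  assumes "degree p \<le> m" "degree q \<le> n"
  shows "coeff (p * q) (m + n) = coeff p m * coeff q n"
proof -
  have "coeff (p * q) (m + n) = (\<Sum>i\<le>m + n. coeff p i * coeff q (m + n - i))"
    by (simp add: coeff_mult)
  also have "\<dots> = (\<Sum>i\<in>{m}. coeff p i * coeff q (m + n - i))"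
  proof (rule sum.mono_neutral_right)
    show "\<forall>i\<in>{..m + n} - {m}. coeff p i * coeff q (m + n - i) = 0"
    proof
      fix i assume "i \<in> {..m + n} - {m}"
      then consider "i > m" | "m + n - i > n" by force
      thus "coeff p i * coeff q (m + n - i) = 0"
        using assms by cases (simp_all add: coeff_eq_0)
    qed
  qed auto
  finally show ?thesis by simp
qed

lemma coeff_power_degree_bound:
  fixes p :: "'a::comm_semiring_1 poly"
  assumes "degree p \<le> m"
  shows "degree (p ^ k) \<le> k * m" and "coeff (p ^ k) (k * m) = coeff p m ^ k"
proof (induction k)
  case (Suc k)
  { case 1
    show ?case using Suc(1) assms degree_mult_le[of p "p ^ k"] by simp
  next
    case 2
    show ?case using coeff_mult_degree_bound[OF assms Suc(1)] Suc(2) by simp }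
qed simp_all

lemma coeff_prod_degree_bound:
  fixes f :: "'i \<Rightarrow> 'a::comm_semiring_1 poly"
  assumes "\<And>i. i \<in> I \<Longrightarrow> degree (f i) \<le> m i"
  shows "degree (\<Prod>i\<in>I. f i) \<le> (\<Sum>i\<in>I. m i)"
    and "coeff (\<Prod>i\<in>I. f i) (\<Sum>i\<in>I. m i) = (\<Prod>i\<in>I. coeff (f i) (m i))"
proof -
  have "degree (\<Prod>i\<in>I. f i) \<le> (\<Sum>i\<in>I. m i) \<and>
        coeff (\<Prod>i\<in>I. f i) (\<Sum>i\<in>I. m i) = (\<Prod>i\<in>I. coeff (f i) (m i))"
    using assms
  proof (induction I rule: infinite_finite_induct)
    case (insert i I)
    hence *: "degree (f i) \<le> m i" "degree (\<Prod>i\<in>I. f i) \<le> (\<Sum>i\<in>I. m i)" by auto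
    have "degree (f i * (\<Prod>i\<in>I. f i)) \<le> m i + (\<Sum>i\<in>I. m i)"
      using degree_mult_le[of "f i" "\<Prod>i\<in>I. f i"] * by linarith
    with insert coeff_mult_degree_bound[OF *] show ?case by simp
  qed auto
  thus "degree (\<Prod>i\<in>I. f i) \<le> (\<Sum>i\<in>I. m i)"
    and "coeff (\<Prod>i\<in>I. f i) (\<Sum>i\<in>I. m i) = (\<Prod>i\<in>I. coeff (f i) (m i))" by auto
qed

lemma degree_pcompose_bound:
  fixes g A :: "'a::comm_semiring_1 poly"
  assumes "degree g \<le> N" "degree A \<le> d"
  shows "degree (pcompose g A) \<le> N * d"
  using degree_pcompose_le[of g A] mult_le_mono[OF assms] by (rule order_trans)

text \<open>For \<open>d > 0\<close> the constants added in Horner's scheme stay below the top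
  index; for \<open>d = 0\<close> they would all contribute to it.\<close>

lemma coeff_pcompose_degree_bound:
  fixes g A :: "'a::comm_ring_1 poly"
  assumes "degree g \<le> N" "degree A \<le> d" "d > 0"
  shows "coeff (pcompose g A) (N * d) = coeff g N * coeff A d ^ N"
  using assms(1)
proof (induction g arbitrary: N)
  case (pCons c g)
  show ?case
  proof (cases N)
    case 0
    with pCons.prems have "g = 0" by (auto split: if_splits)
    thus ?thesis using 0 by (simp add: pcompose_pCons)
  next
    case (Suc M)
    with pCons.prems have M: "degree g \<le> M" by (auto split: if_splits)
    have "coeff (A * pcompose g A) (d + M * d) = coeff A d * coeff (pcompose g A) (M * d)"
      by (intro coeff_mult_degree_bound assms degree_pcompose_bound M)
    with pCons.IH[OF M] Suc assms(3) show ?thesis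
      by (simp add: pcompose_pCons coeff_pCons mult_ac split: nat.splits)
  qed
qed simp

section \<open>Differences of compositions\<close>

text \<open>Horner's scheme gives
  \<open>(c + A g(A)) - (c + B g(B)) = (A - B) g(A) + B (g(A) - g(B))\<close>, so the difference
  quotient \<open>W\<close> is built by induction. Its top coefficient is the derivative of
  \<open>coeff g N * t ^ N\<close> at \<open>a\<close>.\<close>

lemma pcompose_diff_factor:
  fixes g A B :: "'a::comm_ring_1 poly"
  assumes "degree g \<le> N" "degree A \<le> d" "degree B \<le> d" "coeff A d = a" "coeff B d = a" "d > 0"
  shows "\<exists>W. pcompose g A - pcompose g B = (A - B) * W \<and> degree W \<le> (N - 1) * d \<and>
             coeff W ((N - 1) * d) = of_nat N * coeff g N * a ^ (N - 1)"
  using assms(1)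
proof (induction g arbitrary: N)
  case 0
  show ?case by (rule exI[of _ 0]) simp
next
  case (pCons c g)
  show ?case
  proof (cases N)
    case 0
    with pCons.prems have "g = 0" by (auto split: if_splits)
    thus ?thesis using 0 by (intro exI[of _ 0]) (simp add: pcompose_pCons)
  next
    case (Suc M)
    with pCons.prems have M: "degree g \<le> M" by (auto split: if_splits)
    from pCons.IH[OF M] obtain W where W: "pcompose g A - pcompose g B = (A - B) * W"
      "degree W \<le> (M - 1) * d" "coeff W ((M - 1) * d) = of_nat M * coeff g M * a ^ (M - 1)"
      by auto
    define V where "V = pcompose g A + B * W"
    have "pcompose (pCons c g) A - pcompose (pCons c g) B = (A - B) * V"
    proof -
      have "pcompose (pCons c g) A - pcompose (pCons c g) B
              = (A - B) * pcompose g A + B * (pcompose g A - pcompose g B)"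
        by (simp add: pcompose_pCons algebra_simps)
      thus ?thesis unfolding W(1) V_def by (simp add: algebra_simps)
    qed
    moreover have "degree (B * W) \<le> M * d \<and> coeff (B * W) (M * d) = of_nat M * coeff g M * a ^ M"
    proof (cases M)
      case 0
      \<comment> \<open>Here \<open>M - 1\<close> truncates to 0, so \<open>W\<close> is a constant,
        and the factor \<open>of_nat M\<close> makes this constant vanish.\<close>
      hence "W = 0" using W(2,3) by (metis degree_0_id diff_is_0_eq' le_zero_eq mult_zero_left
            of_nat_0 pCons_0_0 zero_le)
      thus ?thesis using 0 by simp
    next
      case (Suc L)
      have "degree (B * W) \<le> d + (M - 1) * d"
        using degree_mult_le[of B W] W(2) assms(3) by linarith
      moreover have "coeff (B * W) (d + (M - 1) * d) = of_nat M * coeff g M * a ^ M"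
        using coeff_mult_degree_bound[OF assms(3) W(2)] Suc assms(5) W(3) by (simp add: mult_ac)
      ultimately show ?thesis using Suc by simp
    qed
    moreover have "degree (pcompose g A) \<le> M * d" "coeff (pcompose g A) (M * d) = coeff g M * a ^ M"
      using M assms degree_pcompose_bound coeff_pcompose_degree_bound by metis+
    ultimately show ?thesis unfolding Suc
      by (intro exI[of _ V]) (auto simp: V_def algebra_simps intro: degree_add_le)
  qed
qed

text \<open>As in the mean value theorem, \<open>g(A) - g(B)\<close> behaves like \<open>(A - B) g'(A)\<close>.\<close>

lemma degree_pcompose_diff_ge:
  fixes g A B :: "'a::{idom, ring_char_0} poly"
  assumes "degree A = d" "degree B = d" "lead_coeff A = lead_coeff B" "A \<noteq> B" "degree g > 0"
  shows "degree (pcompose g A - pcompose g B) \<ge> degree (A - B) + (degree g - 1) * d"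
proof -
  have d: "d > 0"
  proof (rule ccontr)
    assume "\<not> d > 0"
    with assms(1-3) have "A = B" by (metis degree_0_id gr0I)
    with assms(4) show False by simp
  qed
  define N where "N = degree g"
  obtain W where W: "pcompose g A - pcompose g B = (A - B) * W"
      "coeff W ((N - 1) * d) = of_nat N * coeff g N * (lead_coeff A) ^ (N - 1)"
    using pcompose_diff_factor[of g N A d B "lead_coeff A"] assms d by (auto simp: N_def)
  have "A \<noteq> 0" "g \<noteq> 0" using d assms by auto
  hence nz: "coeff W ((N - 1) * d) \<noteq> 0" unfolding W(2) using assms(5) by (simp add: N_def)
  hence "degree W \<ge> (N - 1) * d" by (rule le_degree)
  moreover have "W \<noteq> 0" using nz by auto
  ultimately show ?thesis using assms(4) by (simp add: W(1) degree_mult_eq N_def)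
qed

lemma degree_diff_less_of_lead_coeff_eq:
  fixes A B :: "'a::ab_group_add poly"
  assumes "degree A = d" "degree B = d" "lead_coeff A = lead_coeff B" "d > 0"
  shows "degree (A - B) < d"
proof (rule ccontr)
  assume "\<not> degree (A - B) < d"
  with degree_diff_le[of A d B] assms have "degree (A - B) = d" by simp
  with assms have "lead_coeff (A - B) = 0" by simp
  hence "A - B = 0" by (simp only: leading_coeff_0_iff)
  with \<open>degree (A - B) = d\<close> assms(4) show False by simp
qed

section \<open>Functional equations for univariate polynomials\<close>

text \<open>The leading term \<open>B\<close> satisfies the same equation. In the difference of the
  two equations the left side has degree \<open>p * degree (f - B)\<close>, the right side at least
  \<open>degree (f - B) + (p - 1) * degree f\<close>. As \<open>degree (f - B) < degree f\<close>,
  this is impossible unless \<open>f = B\<close>.\<close>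

lemma power_substitution_imp_monom:
  fixes f :: "'a::{idom, ring_char_0} poly"
  assumes "p \<ge> 2" "a \<noteq> 0" "smult a (pcompose f (monom 1 p)) = smult b (f ^ p)"
  shows "f = monom (lead_coeff f) (degree f)"
proof (rule ccontr)
  define k where "k = degree f"
  define B where "B = monom (lead_coeff f) k"
  define X where "X = monom (1::'a) p"
  assume "f \<noteq> monom (lead_coeff f) (degree f)"
  hence ne: "f \<noteq> B" by (simp add: B_def k_def)
  hence "f \<noteq> 0" by (auto simp: B_def)
  have X: "degree X = p" "coeff X p = 1" by (simp_all add: X_def degree_monom_eq)
  have pw: "pcompose X F = F ^ p" for F
    unfolding X_def by (induction p) (simp_all add: monom_0 monom_Suc pcompose_pCons)
  have "k > 0"
  proof (rule ccontr)
    assume "\<not> k > 0"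
    thus False using ne by (metis B_def degree_0_id gr0I k_def monom_0)
  qed
  have B: "degree B = k" "lead_coeff B = lead_coeff f"
    using \<open>f \<noteq> 0\<close> by (simp_all add: B_def degree_monom_eq)
  have "coeff (pcompose f X) (k * p) = lead_coeff f * 1"
    using coeff_pcompose_degree_bound[of f k X p] X assms(1) by (simp add: k_def)
  moreover have "coeff (f ^ p) (k * p) = lead_coeff f ^ p"
    using coeff_power_degree_bound(2)[of f k p] by (simp add: k_def mult.commute)
  ultimately have top: "a * lead_coeff f = b * lead_coeff f ^ p"
    using assms(3) by (metis X_def coeff_smult mult.right_neutral)
  hence "b \<noteq> 0" using assms(2) \<open>f \<noteq> 0\<close> by auto
  have "smult a (pcompose B X) = smult b (B ^ p)"
    by (rule poly_eqI_of_nat)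
       (simp add: poly_pcompose B_def X_def poly_monom power_mult_distrib mult.assoc[symmetric] top
             flip: power_mult mult.commute[of p k])
  hence "smult a (pcompose (f - B) X) = smult b (pcompose X f - pcompose X B)"
    using assms(3) by (simp add: pcompose_diff smult_diff_right pw X_def[symmetric])
  hence "degree (pcompose (f - B) X) = degree (pcompose X f - pcompose X B)"
    using assms(2) \<open>b \<noteq> 0\<close> by (metis degree_smult_eq)
  also have "degree (pcompose (f - B) X) = degree (f - B) * p"
    by (simp add: degree_pcompose X)
  finally have "degree (f - B) + (p - 1) * k \<le> degree (f - B) * p"
    using degree_pcompose_diff_ge[of f k B X] B ne assms(1) by (simp add: k_def X)
  moreover have "degree (f - B) < k"
    using degree_diff_less_of_lead_coeff_eq[of f k B] B \<open>k > 0\<close> by (simp add: k_def)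
  hence "degree (f - B) * (p - 1) < k * (p - 1)" using assms(1) by simp
  moreover have "degree (f - B) * p = degree (f - B) + degree (f - B) * (p - 1)"
    using assms(1) by (cases p) simp_all
  ultimately show False by (simp add: mult.commute)
qed

text \<open>\<open>d\<close> is a nonzero combination of \<open>a\<close> and \<open>b\<close> of
  least degree: the remainder of a combination modulo \<open>d\<close> is again a combination, of
  smaller degree, and so must be zero.\<close>

lemma bezout_poly:
  fixes a b :: "'a::field poly"
  assumes "a \<noteq> 0"
  obtains d u v r s where "d \<noteq> 0" "a = d * r" "b = d * s" "u * r + v * s = 1"
proof -
  define I where "I d \<longleftrightarrow> d \<noteq> 0 \<and> (\<exists>u v. d = u * a + v * b)" for d
  have "I a" using assms by (auto simp: I_def intro: exI[of _ 1] exI[of _ 0])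
  then obtain d where d: "I d" "\<And>e. I e \<Longrightarrow> degree d \<le> degree e"
    using ex_has_least_nat[of I a degree] by blast
  then obtain u v where uv: "d = u * a + v * b" "d \<noteq> 0" by (auto simp: I_def)
  have *: "d dvd z" if "z = x * a + y * b" for x y z
  proof (rule ccontr)
    assume "\<not> d dvd z"
    hence nz: "z mod d \<noteq> 0" by (simp add: dvd_eq_mod_eq_0)
    define q where "q = z div d"
    have "z mod d = z - q * d" by (simp add: q_def minus_div_mult_eq_mod)
    also have "\<dots> = (x - q * u) * a + (y - q * v) * b"
      unfolding that uv(1) by (simp add: algebra_simps)
    finally have "I (z mod d)" using nz unfolding I_def by blast
    with d(2) degree_mod_less'[OF uv(2) nz] show False by fastforce
  qed
  from *[of a 1 0] *[of b 0 1] obtain r s where rs: "a = d * r" "b = d * s" by (auto elim!: dvdE)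
  have "d * (u * r + v * s) = d * 1" using uv(1) by (simp add: rs algebra_simps)
  hence "u * r + v * s = 1" using uv(2) by (simp only: mult_cancel_left) simp
  with that rs uv(2) show thesis by blast
qed

text \<open>Over an algebraically closed field, the root set of \<open>h\<close> equals its preimage under \<open>g\<close>, so every
  root is a totally ramified value of \<open>g\<close>, and there can be only one. The proof replaces the root
  set by the radical \<open>r\<close> of \<open>h\<close>, obtained from \<open>gcd h h'\<close>: differentiating the assumption shows
  that \<open>r(g)\<close> divides \<open>r g'\<close>, which forces \<open>degree r = 1\<close>.\<close>

lemma pcompose_eq_power_imp_shifted_power:
  fixes h g :: "'a::field_char_0 poly"
  assumes "degree h > 0" "degree g = p" "p \<ge> 2" "pcompose h g = smult e (h ^ p)"
  obtains \<rho> where "g = smult (lead_coeff g) ([:-\<rho>, 1:] ^ p) + [:\<rho>:]"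
proof -
  have h0: "h \<noteq> 0" using assms(1) by auto
  obtain d u v r s where bz: "d \<noteq> 0" "h = d * r" "pderiv h = d * s" "u * r + v * s = 1"
    by (rule bezout_poly[OF h0, of "pderiv h"])
  have h': "pderiv h \<noteq> 0" using assms(1) by (simp add: pderiv_eq_0_iff)
  have r_nz: "r \<noteq> 0" and s0: "s \<noteq> 0" using bz h0 h' by auto
  have g': "pderiv g \<noteq> 0" "degree (pderiv g) = p - 1"
    using assms by (auto simp: pderiv_eq_0_iff degree_pderiv)
  \<comment> \<open>Since \<open>h = d * r\<close> and \<open>h' = d * s\<close>, the degree of
    \<open>r\<close> exceeds that of \<open>s\<close> by one.\<close>
  have "degree (d * s) = degree (d * r) - 1"
    using bz degree_pderiv[of h] by simp
  hence deg_r: "degree r > 0" using bz r_nz s0 assms(1) by (auto simp: degree_mult_eq)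
  have hg: "pcompose h g = pcompose d g * pcompose r g"
    and h'g: "pcompose (pderiv h) g = pcompose d g * pcompose s g"
    by (subst bz(2), rule pcompose_mult) (subst bz(3), rule pcompose_mult)
  \<comment> \<open>The derivative of \<open>h(g) = e * h ^ p\<close> is multiplied by
    \<open>r\<close>. The relation \<open>h' * r = s * h\<close> completes
    \<open>h ^ (p - 1)\<close> to \<open>h ^ p\<close>, which with the factor \<open>e\<close> is
    \<open>h(g)\<close> again, and \<open>d(g)\<close> cancels.\<close>
  have "pderiv (pcompose h g) = smult (e * of_nat p) (h ^ (p - 1) * pderiv h)"
    using assms(3) unfolding assms(4) by (simp add: pderiv_smult pderiv_power mult_ac)
  hence "r * (pcompose (pderiv h) g * pderiv g) = smult (e * of_nat p) (h ^ (p - 1) * (pderiv h * r))"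
    by (simp add: pderiv_pcompose mult_ac)
  also have "pderiv h * r = s * h" using bz by (simp add: mult_ac)
  also have "smult (e * of_nat p) (h ^ (p - 1) * (s * h)) = smult (of_nat p) (s * smult e (h ^ p))"
    using assms(3) by (cases p) (simp_all add: mult_ac)
  also have "\<dots> = smult (of_nat p) (s * pcompose h g)" by (simp only: assms(4))
  finally have "pcompose d g * (pcompose s g * (r * pderiv g))
      = pcompose d g * smult (of_nat p) (s * pcompose r g)"
    unfolding hg h'g by (simp add: mult_ac)
  moreover have "pcompose d g \<noteq> 0" using bz(1) assms pcompose_eq_0[of d g] by auto
  ultimately have eq: "pcompose s g * (r * pderiv g) = smult (of_nat p) (s * pcompose r g)"
    by (simp only: mult_cancel_left mult_smult_right[symmetric]) simp
  have "pcompose (u * r + v * s) g = 1" by (simp only: bz(4) pcompose_1)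
  \<comment> \<open>Multiplying by \<open>1 = u(g) r(g) + v(g) s(g)\<close> shows that
    \<open>r(g)\<close> divides \<open>r * g'\<close>.\<close>
  hence "r * pderiv g = (pcompose u g * pcompose r g + pcompose v g * pcompose s g) * (r * pderiv g)"
    by (simp add: pcompose_add pcompose_mult)
  also have "\<dots> = pcompose r g * (pcompose u g * (r * pderiv g))
      + pcompose v g * (pcompose s g * (r * pderiv g))"
    by (simp add: algebra_simps)
  also have "\<dots> = pcompose r g * (pcompose u g * (r * pderiv g) + smult (of_nat p) (pcompose v g * s))"
    unfolding eq by (simp add: algebra_simps)
  finally obtain q where q: "r * pderiv g = pcompose r g * q" by blast
  moreover have "r * pderiv g \<noteq> 0" using r_nz g' by simp
  ultimately have "q \<noteq> 0" "pcompose r g \<noteq> 0" by auto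
  \<comment> \<open>Equivalently, \<open>(p - 1) * (degree r - 1) + degree q = 0\<close>, so both
    summands vanish.\<close>
  hence deg: "degree r + (p - 1) = p * degree r + degree q"
    using arg_cong[OF q, of degree] r_nz g' assms(2) by (simp add: degree_mult_eq degree_pcompose mult.commute)
  obtain k where k: "p = k + 2" using assms(3) by (metis add.commute le_Suc_ex)
  obtain l where l: "degree r = Suc l" using deg_r by (cases "degree r") auto
  have deg1: "degree r = 1" "degree q = 0" using deg unfolding k l by simp_all
  define r0 r1 where "r0 = coeff r 0" and "r1 = coeff r 1"
  have r: "r = [:r0, r1:]" "r1 \<noteq> 0"
    using deg1(1) r_nz leading_coeff_0_iff[of r] by (auto simp: r0_def r1_def poly_eq_iff coeff_pCons coeff_eq_0 split: nat.splits)
  obtain q0 where q0: "q = [:q0:]" by (rule degree_eq_zeroE[OF deg1(2)])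
  \<comment> \<open>\<open>\<rho>\<close> is the root of the linear \<open>r\<close>. Moving it to
    the origin, in argument and in value, turns the relation into Euler's equation
    \<open>t * F' = q0 * F\<close>, whose nonzero polynomial solutions are monomials.\<close>
  define \<rho> where "\<rho> = - r0 / r1"
  define F where "F = pcompose (g - [:\<rho>:]) [:\<rho>, 1:]"
  have r_eq: "r = smult r1 [:-\<rho>, 1:]" using r by (simp add: \<rho>_def)
  have "smult r1 ([:-\<rho>, 1:] * pderiv g) = smult r1 ((g - [:\<rho>:]) * q)"
    using q unfolding r_eq by (simp add: pcompose_smult pcompose_pCons smult_diff_right algebra_simps)
  hence "[:-\<rho>, 1:] * pderiv g = (g - [:\<rho>:]) * q" by (rule smult_cancel[OF r(2)])
  hence ode: "[:-\<rho>, 1:] * pderiv g = smult q0 (g - [:\<rho>:])"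
    unfolding q0 by simp
  have "pderiv F = pcompose (pderiv g) [:\<rho>, 1:]"
    unfolding F_def by (simp add: pderiv_pcompose pderiv_diff pderiv_pCons)
  moreover have "pcompose [:-\<rho>, 1:] [:\<rho>, 1:] = [:0, 1:]" by (simp add: pcompose_pCons)
  ultimately have "[:0, 1:] * pderiv F = pcompose ([:-\<rho>, 1:] * pderiv g) [:\<rho>, 1:]"
    by (simp only: pcompose_mult)
  also have "\<dots> = smult q0 F" unfolding ode F_def by (simp add: pcompose_smult)
  finally have "pCons 0 (pderiv F) = smult q0 F" by simp
  have Fi: "of_nat i * coeff F i = q0 * coeff F i" for i
    using arg_cong[OF \<open>pCons 0 (pderiv F) = smult q0 F\<close>, of "\<lambda>f. coeff f i"]
    by (cases i) (simp_all add: coeff_pderiv)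
  have "degree (g - [:\<rho>:]) = p"
    using degree_add_eq_left[of "- [:\<rho>:]" g] assms
    by (simp only: diff_conv_add_uminus degree_minus) simp
  hence dF: "degree F = p" unfolding F_def by (simp add: degree_pcompose)
  hence "coeff F p \<noteq> 0" using assms(3) by (metis degree_0 leading_coeff_0_iff not_numeral_le_zero)
  with Fi[of p] have "q0 = of_nat p" by simp
  with Fi have "coeff F i = 0" if "i \<noteq> p" for i using that by force
  hence F: "F = monom (coeff F p) p" by (intro poly_eqI) (auto simp: coeff_monom)
  have "pcompose F [:-\<rho>, 1:] = g - [:\<rho>:]"
    unfolding F_def by (simp add: pcompose_assoc[symmetric] pcompose_pCons)
  moreover have "pcompose F [:-\<rho>, 1:] = smult (coeff F p) ([:-\<rho>, 1:] ^ p)"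
    by (subst F) (intro poly_eqI_of_nat, simp add: poly_pcompose poly_monom)
  ultimately have g: "g = smult (coeff F p) ([:-\<rho>, 1:] ^ p) + [:\<rho>:]" by (simp add: algebra_simps)
  have "coeff g p = coeff F p"
    using assms(3) by (subst g) (simp add: coeff_linear_power coeff_pCons split: nat.splits)
  with g assms(2) have "g = smult (lead_coeff g) ([:-\<rho>, 1:] ^ p) + [:\<rho>:]" by simp
  thus thesis by (rule that)
qed

text \<open>Here \<open>H\<close> is a bivariate polynomial \<open>H(x, y)\<close>, seen as a polynomial in \<open>y\<close>, such that
  \<open>g(H(x, y)) = H(g(x), g(y))\<close>.\<close>

lemma lead_coeff_of_semiconjugate:
  fixes g :: "'a::{idom, ring_char_0} poly" and H :: "'a poly poly"
  defines "A \<equiv> \<lambda>x. map_poly (\<lambda>h. poly h x) H"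
  assumes p: "degree g = p" "p \<ge> 2"
    and comm: "\<And>k::nat. pcompose g (A (of_nat k)) = pcompose (A (poly g (of_nat k))) g"
    and H: "degree H > 0" "degree (coeff H j) > 0"
  shows "degree (lead_coeff H) > 0"
    and "smult (lead_coeff g ^ degree H) (pcompose (lead_coeff H) g)
           = smult (lead_coeff g) (lead_coeff H ^ p)"
proof -
  define d where "d = degree H"
  have coeff_A: "coeff (A x) i = poly (coeff H i) x" for x i
    by (simp add: A_def coeff_map_poly)
  have deg_A: "degree (A x) \<le> d" for x
    by (rule degree_le) (simp add: coeff_A d_def coeff_eq_0)
  show "smult (lead_coeff g ^ degree H) (pcompose (lead_coeff H) g)
           = smult (lead_coeff g) (lead_coeff H ^ p)"
  proof (rule poly_eqI_of_nat)
    fix k :: nat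
    \<comment> \<open>For a fixed integer \<open>x\<close> both sides of the commutation are
      polynomials in \<open>y\<close>; their coefficients at \<open>y ^ (p * d)\<close> are
      compared.\<close>
    have "lead_coeff g * poly (lead_coeff H) (of_nat k) ^ p = coeff (pcompose g (A (of_nat k))) (p * d)"
      using coeff_pcompose_degree_bound[of g p "A (of_nat k)" d] p H(1) deg_A
      by (simp add: coeff_A d_def)
    also have "\<dots> = coeff (pcompose (A (poly g (of_nat k))) g) (d * p)"
      unfolding comm by (simp add: mult.commute)
    also have "\<dots> = poly (lead_coeff H) (poly g (of_nat k)) * lead_coeff g ^ d"
      using coeff_pcompose_degree_bound[of "A (poly g (of_nat k))" d g p] p deg_A
      by (simp add: coeff_A d_def)
    finally show "poly (smult (lead_coeff g ^ degree H) (pcompose (lead_coeff H) g)) (of_nat k)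
        = poly (smult (lead_coeff g) (lead_coeff H ^ p)) (of_nat k)"
      by (simp add: poly_pcompose d_def mult.commute)
  qed
  show "degree (lead_coeff H) > 0"
  proof (rule ccontr)
    assume "\<not> degree (lead_coeff H) > 0"
    then obtain h where h: "coeff H d = [:h:]" by (auto simp: d_def elim: degree_eq_zeroE)
    have "H \<noteq> 0" using H(1) by auto
    hence "h \<noteq> 0" using h by (metis d_def leading_coeff_0_iff pCons_0_0)
    \<comment> \<open>Let \<open>m < d\<close> be the last index with a nonconstant coefficient. For
      a suitable \<open>x\<close>, \<open>A x - A 0\<close> has degree \<open>m\<close>, so
      \<open>g(A x) - g(A 0)\<close> has degree at least \<open>m + (p - 1) * d\<close>. The
      commutation bounds this degree by \<open>m * p\<close>, which is smaller.\<close>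
    define J where "J = {i. degree (coeff H i) > 0}"
    have "J \<subseteq> {..d}" unfolding J_def d_def
      by (auto simp: le_degree intro!: le_degree)
    hence fin: "finite J" by (rule finite_subset) simp
    have "j \<in> J" using H(2) by (simp add: J_def)
    define m where "m = Max J"
    have "m \<in> J" using fin \<open>j \<in> J\<close> unfolding m_def by (intro Max_in) auto
    have above: "degree (coeff H i) = 0" if "i > m" for i
      using that Max_ge[OF fin, of i] unfolding m_def J_def by fastforce
    have "m \<noteq> d" using \<open>m \<in> J\<close> h by (auto simp: J_def)
    hence "m < d" using \<open>m \<in> J\<close> \<open>J \<subseteq> {..d}\<close> by force
    obtain k :: nat where k: "poly (coeff H m) (of_nat k) \<noteq> poly (coeff H m) 0"
    proof (rule ccontr)
      assume "\<not> thesis"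
      hence "coeff H m = [:poly (coeff H m) 0:]"
        using that by (intro poly_eqI_of_nat) auto
      thus False using \<open>m \<in> J\<close> unfolding J_def
        by (metis degree_pCons_0 less_numeral_extra(3) mem_Collect_eq)
    qed
    define x where "x = (of_nat k :: 'a)"
    have deg_eq: "degree (A z) = d" for z
      using deg_A[of z] \<open>h \<noteq> 0\<close> by (intro antisym le_degree) (auto simp: coeff_A h)
    have low: "degree (A z - A w) \<le> m" for z w
    proof (rule degree_le, intro allI impI)
      fix i assume "i > m"
      from degree_eq_zeroE[OF above[OF this]] obtain a where "coeff H i = [:a:]" .
      thus "coeff (A z - A w) i = 0" by (simp add: coeff_A)
    qed
    have ne: "coeff (A x - A 0) m \<noteq> 0" using k by (simp add: coeff_A x_def)
    hence deg_m: "degree (A x - A 0) = m" using low by (intro antisym le_degree)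
    from ne have "A x \<noteq> A 0" by auto
    hence "m + (p - 1) * d \<le> degree (pcompose g (A x) - pcompose g (A 0))"
      using degree_pcompose_diff_ge[of "A x" d "A 0" g] deg_eq p deg_m
      by (auto simp: coeff_A h)
    also have "pcompose g (A x) - pcompose g (A 0) = pcompose (A (poly g x) - A (poly g 0)) g"
      using comm[of k] comm[of 0] by (simp add: x_def pcompose_diff)
    also have "degree \<dots> \<le> m * p"
      using low p by (intro degree_pcompose_bound) auto
    finally have "m + (p - 1) * d \<le> m * p" .
    moreover have "m * (p - 1) < d * (p - 1)" using \<open>m < d\<close> p(2) by simp
    moreover have "m * p = m + m * (p - 1)" using p(2) by (cases p) simp_all
    ultimately show False by (simp add: mult.commute)
  qed
qed

section \<open>Multivariate polynomials and substitution\<close>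

lemma poly_fun_eq_sum_superset:
  assumes "finite S" "Poly_Mapping.keys P \<subseteq> S"
  shows "poly_fun P x
    = (\<Sum>m\<in>S. Poly_Mapping.lookup P m * (\<Prod>i\<in>UNIV. (x $ i) ^ Poly_Mapping.lookup m i))"
  unfolding poly_fun_def by (rule sum.mono_neutral_left) (use assms in \<open>auto simp: in_keys_iff\<close>)

lemma poly_fun_add: "poly_fun (P + Q) x = poly_fun P x + poly_fun Q x"
  using keys_add[of P Q]
  by (simp add: poly_fun_eq_sum_superset[of "Poly_Mapping.keys P \<union> Poly_Mapping.keys Q"]
        lookup_add ring_distribs sum.distrib)

lemma poly_fun_diff: "poly_fun (P - Q) x = poly_fun P x - poly_fun Q x"
  using poly_fun_add[of "P - Q" Q x] by (simp add: algebra_simps)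

lemma poly_fun_zero [simp]: "poly_fun 0 x = 0"
  by (simp add: poly_fun_def)

lemma poly_fun_sum: "poly_fun (\<Sum>i\<in>I. f i) x = (\<Sum>i\<in>I. poly_fun (f i) x)"
  by (induction I rule: infinite_finite_induct) (simp_all add: poly_fun_add)

lemma poly_fun_single:
  "poly_fun (Poly_Mapping.single m c) x = c * (\<Prod>i\<in>UNIV. (x $ i) ^ Poly_Mapping.lookup m i)"
  by (subst poly_fun_eq_sum_superset[of "{m}"]) (auto split: if_splits)

lemma poly_mapping_eq_sum_single:
  "P = (\<Sum>m\<in>Poly_Mapping.keys P. Poly_Mapping.single m (Poly_Mapping.lookup P m))"
  by (rule poly_mapping_eqI) (auto simp: lookup_sum lookup_single when_def in_keys_iff)

lemma poly_fun_mult: "poly_fun (P * Q) x = poly_fun P x * poly_fun Q x"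
proof -
  have "poly_fun (P * Q) x = poly_fun
      ((\<Sum>m\<in>Poly_Mapping.keys P. Poly_Mapping.single m (Poly_Mapping.lookup P m)) *
       (\<Sum>m\<in>Poly_Mapping.keys Q. Poly_Mapping.single m (Poly_Mapping.lookup Q m))) x"
    by (simp flip: poly_mapping_eq_sum_single)
  thus ?thesis
    by (simp add: sum_product poly_fun_sum mult_single poly_fun_single lookup_add power_add
          prod.distrib poly_fun_def[of P x] poly_fun_def[of Q x] mult_ac)
qed

lemma poly_fun_const [simp]: "poly_fun (const c) x = c"
  by (simp add: const_def poly_fun_single)

lemma poly_fun_vars [simp]: "poly_fun (vars $ i) x = x $ i"
proof -
  have "(\<Prod>j\<in>UNIV. (x $ j) ^ Poly_Mapping.lookup (Poly_Mapping.single i 1) j)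
      = (\<Prod>j\<in>UNIV. if j = i then x $ j else 1)"
    by (intro prod.cong) (auto simp: lookup_single when_def)
  thus ?thesis by (simp add: vars_def poly_fun_single)
qed

lemma poly_fun_one [simp]: "poly_fun 1 x = 1"
  using poly_fun_single[of 0 1 x] by simp

lemma poly_fun_power: "poly_fun (P ^ k) x = poly_fun P x ^ k"
  by (induction k) (simp_all add: poly_fun_mult)

lemma poly_fun_prod: "poly_fun (\<Prod>i\<in>I. f i) x = (\<Prod>i\<in>I. poly_fun (f i) x)"
  by (induction I rule: infinite_finite_induct) (simp_all add: poly_fun_mult)

lemma poly_fun_poly_subst: "poly_fun (poly_subst P q) x = poly_fun P (\<chi> i. poly_fun (q $ i) x)"
  unfolding poly_subst_def
  by (simp add: poly_fun_sum poly_fun_mult poly_fun_prod poly_fun_power poly_fun_def[of P])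

section \<open>Extension to the fraction field\<close>

lemma lookup_fract_poly_ext [simp]:
  "Poly_Mapping.lookup (fract_poly_ext P) m = to_fract (Poly_Mapping.lookup P m)"
  by (simp add: fract_poly_ext_def map.rep_eq when_def)

lemma keys_fract_poly_ext [simp]: "Poly_Mapping.keys (fract_poly_ext P) = Poly_Mapping.keys P"
  by (auto simp: in_keys_iff)

lemma to_fract_sum: "to_fract (\<Sum>i\<in>I. f i) = (\<Sum>i\<in>I. to_fract (f i))"
  by (induction I rule: infinite_finite_induct) simp_all

lemma to_fract_prod: "to_fract (\<Prod>i\<in>I. f i) = (\<Prod>i\<in>I. to_fract (f i))"
  by (induction I rule: infinite_finite_induct) simp_all

lemma to_fract_power: "to_fract (x ^ k) = to_fract x ^ k"
  by (induction k) simp_all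

lemma poly_fun_fract_poly_ext:
  "poly_fun (fract_poly_ext P) (\<chi> i. to_fract (x $ i)) = to_fract (poly_fun P x)"
  by (simp add: poly_fun_def to_fract_sum to_fract_prod to_fract_power)

section \<open>Homogeneous parts\<close>

lemma lookup_hom_part:
  "Poly_Mapping.lookup (hom_part k P) m = (if mdeg m = k then Poly_Mapping.lookup P m else 0)"
  by (auto simp: hom_part_def lookup_sum lookup_single when_def in_keys_iff)

lemma keys_hom_part: "Poly_Mapping.keys (hom_part k P) = {m \<in> Poly_Mapping.keys P. mdeg m = k}"
  by (auto simp: in_keys_iff lookup_hom_part split: if_splits)

lemma hom_part_fract_poly_ext: "hom_part k (fract_poly_ext P) = fract_poly_ext (hom_part k P)"
  by (rule poly_mapping_eqI) (simp add: lookup_hom_part)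

lemma mdeg_le_total_degree: "m \<in> Poly_Mapping.keys P \<Longrightarrow> mdeg m \<le> total_degree P"
  by (simp add: total_degree_def)

lemma hom_part_total_degree_nonzero:
  assumes "P \<noteq> 0"
  shows "hom_part (total_degree P) P \<noteq> 0"
proof -
  have "total_degree P \<in> mdeg ` Poly_Mapping.keys P"
  proof (cases "total_degree P = 0")
    \<comment> \<open>The value 0 could be the default from \<open>insert\<close>, but then every
      monomial of \<open>P\<close> has degree 0 and attains it.\<close>
    case True
    obtain m where "m \<in> Poly_Mapping.keys P" using assms by (metis ex_in_conv keys_eq_empty)
    with mdeg_le_total_degree[OF this] True show ?thesis by force
  next
    case False
    have "total_degree P \<in> insert 0 (mdeg ` Poly_Mapping.keys P)"
      unfolding total_degree_def by (rule Max_in) auto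
    with False show ?thesis by simp
  qed
  then obtain m where "m \<in> Poly_Mapping.keys (hom_part (total_degree P) P)"
    by (auto simp: keys_hom_part)
  thus ?thesis by auto
qed

lemma poly_fun_hom_part_scale:
  "poly_fun (hom_part k P) (\<chi> i. a * x i) = a ^ k * poly_fun (hom_part k P) (\<chi> i. x i)"
proof -
  have "(\<Prod>i\<in>UNIV. (a * x i) ^ Poly_Mapping.lookup m i)
      = a ^ mdeg m * (\<Prod>i\<in>UNIV. x i ^ Poly_Mapping.lookup m i)" for m
    by (simp add: power_mult_distrib prod.distrib mdeg_def power_sum)
  thus ?thesis
    by (simp add: poly_fun_def sum_distrib_left keys_hom_part mult_ac)
qed

section \<open>Restriction to polynomial curves\<close>

text \<open>This is the restriction of \<open>P\<close> to the curve with coordinates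
  \<open>F i\<close>; it makes the univariate results on degrees and coefficients
  applicable.\<close>

definition poly_at :: "('n::finite, 'a::comm_ring_1) mpoly \<Rightarrow> ('n \<Rightarrow> 'a poly) \<Rightarrow> 'a poly" where
  "poly_at P F = (\<Sum>m\<in>Poly_Mapping.keys P.
     smult (Poly_Mapping.lookup P m) (\<Prod>i\<in>UNIV. F i ^ Poly_Mapping.lookup m i))"

lemma poly_poly_at: "poly (poly_at P F) t = poly_fun P (\<chi> i. poly (F i) t)"
  by (simp add: poly_at_def poly_fun_def poly_sum poly_prod)

text \<open>A term of degree \<open>k\<close> becomes a polynomial of degree at most
  \<open>k * d\<close>, so only terms of degree \<open>p\<close> reach the index
  \<open>p * d\<close>.\<close>

lemma poly_at_degree_bound:
  assumes "\<And>i. degree (F i) \<le> d" "total_degree P \<le> p" "d > 0"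
  shows "degree (poly_at P F) \<le> p * d"
    and "coeff (poly_at P F) (p * d) = poly_fun (hom_part p P) (\<chi> i. coeff (F i) d)"
proof -
  define M where "M m = (\<Prod>i\<in>UNIV. F i ^ Poly_Mapping.lookup m i)" for m
  have M: "degree (M m) \<le> mdeg m * d"
      "coeff (M m) (mdeg m * d) = (\<Prod>i\<in>UNIV. coeff (F i) d ^ Poly_Mapping.lookup m i)" for m
    using coeff_prod_degree_bound[of UNIV "\<lambda>i. F i ^ Poly_Mapping.lookup m i"
        "\<lambda>i. Poly_Mapping.lookup m i * d"] coeff_power_degree_bound[OF assms(1)]
    by (auto simp: M_def mdeg_def sum_distrib_right)
  have le: "mdeg m * d \<le> p * d" if "m \<in> Poly_Mapping.keys P" for m
    using mdeg_le_total_degree[OF that] assms(2) by simp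
  show "degree (poly_at P F) \<le> p * d"
    unfolding poly_at_def M_def[symmetric]
    by (intro degree_sum_le order.trans[OF degree_smult_le] order.trans[OF M(1)] le) auto
  have "coeff (M m) (p * d) = 0" if "m \<in> Poly_Mapping.keys P" "mdeg m \<noteq> p" for m
    using le_neq_implies_less[OF order.trans[OF mdeg_le_total_degree[OF that(1)] assms(2)] that(2)]
      M(1)[of m] assms(3) by (intro coeff_eq_0) (meson le_less_trans mult_less_mono1)
  hence "coeff (poly_at P F) (p * d)
      = (\<Sum>m\<in>Poly_Mapping.keys (hom_part p P). Poly_Mapping.lookup P m * coeff (M m) (p * d))"
    unfolding poly_at_def M_def[symmetric] coeff_sum coeff_smult keys_hom_part
    by (intro sum.mono_neutral_right) auto
  also have "\<dots> = poly_fun (hom_part p P) (\<chi> i. coeff (F i) d)"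
    unfolding poly_fun_def by (intro sum.cong) (auto simp: keys_hom_part lookup_hom_part M(2)[symmetric])
  finally show "coeff (poly_at P F) (p * d) = poly_fun (hom_part p P) (\<chi> i. coeff (F i) d)" .
qed

lemma monom_power: "monom (a::'a::comm_semiring_1) k ^ n = monom (a ^ n) (k * n)"
  by (induction n) (simp_all add: mult_monom monom_0[symmetric])

lemma prod_monom:
  "(\<Prod>i\<in>I. monom (a i :: 'a::comm_semiring_1) (k i)) = monom (\<Prod>i\<in>I. a i) (\<Sum>i\<in>I. k i)"
  by (induction I rule: infinite_finite_induct) (simp_all add: mult_monom monom_0[symmetric])

lemma poly_at_monom:
  "poly_at P (\<lambda>i. monom (u i) (w i)) = (\<Sum>m\<in>Poly_Mapping.keys P.
     monom (Poly_Mapping.lookup P m * (\<Prod>i\<in>UNIV. u i ^ Poly_Mapping.lookup m i))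
       (\<Sum>i\<in>UNIV. w i * Poly_Mapping.lookup m i))"
  by (simp add: poly_at_def monom_power prod_monom smult_monom)

text \<open>At the point \<open>t u\<close> a term of degree \<open>k\<close> is a multiple of
  \<open>t ^ k\<close>, so lines through the origin separate the homogeneous parts.\<close>

lemma coeff_poly_at_line:
  "coeff (poly_at P (\<lambda>i. monom (u i) 1)) k = poly_fun (hom_part k P) (\<chi> i. u i)"
proof -
  have "coeff (poly_at P (\<lambda>i. monom (u i) 1)) k = (\<Sum>m\<in>Poly_Mapping.keys P.
      if mdeg m = k then Poly_Mapping.lookup P m * (\<Prod>i\<in>UNIV. u i ^ Poly_Mapping.lookup m i) else 0)"
    unfolding poly_at_monom coeff_sum by (intro sum.cong) (auto simp: mdeg_def)
  also have "\<dots> = poly_fun (hom_part k P) (\<chi> i. u i)"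
    unfolding poly_fun_def keys_hom_part by (auto simp: sum.If_cases lookup_hom_part intro!: sum.cong)
  finally show ?thesis .
qed

text \<open>With such weights, Kronecker's substitution \<open>x\<^sub>i \<mapsto> t ^ w\<^sub>i\<close> keeps all terms apart.\<close>

lemma exists_separating_weights:
  fixes S :: "('n::finite \<Rightarrow>\<^sub>0 nat) set"
  assumes "finite S"
  obtains w :: "'n \<Rightarrow> nat" where "inj_on (\<lambda>m. \<Sum>i\<in>UNIV. w i * Poly_Mapping.lookup m i) S"
proof -
  have "\<exists>w :: 'n \<Rightarrow> nat. \<forall>m\<in>S. \<forall>m'\<in>S. (\<Sum>i\<in>I. w i * Poly_Mapping.lookup m i)
      = (\<Sum>i\<in>I. w i * Poly_Mapping.lookup m' i)
      \<longrightarrow> (\<forall>i\<in>I. Poly_Mapping.lookup m i = Poly_Mapping.lookup m' i)" for I :: "'n set"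
  proof (induction I rule: infinite_finite_induct)
    case (insert j I)
    then obtain w :: "'n \<Rightarrow> nat" where w: "\<And>m m'. m \<in> S \<Longrightarrow> m' \<in> S \<Longrightarrow>
        (\<Sum>i\<in>I. w i * Poly_Mapping.lookup m i) = (\<Sum>i\<in>I. w i * Poly_Mapping.lookup m' i)
        \<Longrightarrow> (\<forall>i\<in>I. Poly_Mapping.lookup m i = Poly_Mapping.lookup m' i)" by blast
    \<comment> \<open>All exponents of \<open>j\<close> are less than \<open>B\<close>, so in the
      new weighted sum the exponent of \<open>j\<close> is the last digit to base \<open>B\<close>
      and the old weighted sum is the quotient.\<close>
    define B where "B = Suc (Max (insert 0 ((\<lambda>m. Poly_Mapping.lookup m j) ` S)))"
    have B: "Poly_Mapping.lookup m j < B" if "m \<in> S" for m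
      using that assms unfolding B_def by (intro le_imp_less_Suc Max_ge) auto
    define w' where "w' = (\<lambda>i. B * w i)(j := 1)"
    have sum: "(\<Sum>i\<in>insert j I. w' i * Poly_Mapping.lookup m i)
        = Poly_Mapping.lookup m j + B * (\<Sum>i\<in>I. w i * Poly_Mapping.lookup m i)" for m
    proof -
      have "(\<Sum>i\<in>I. w' i * Poly_Mapping.lookup m i) = B * (\<Sum>i\<in>I. w i * Poly_Mapping.lookup m i)"
        unfolding sum_distrib_left using insert.hyps by (intro sum.cong) (auto simp: w'_def)
      thus ?thesis using insert.hyps by (simp add: w'_def)
    qed
    show ?case
    proof (rule exI[of _ w'], intro ballI impI)
      fix m m' i assume *: "m \<in> S" "m' \<in> S" "i \<in> insert j I"
        "(\<Sum>i\<in>insert j I. w' i * Poly_Mapping.lookup m i)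
           = (\<Sum>i\<in>insert j I. w' i * Poly_Mapping.lookup m' i)"
      note eq = *(4)[unfolded sum]
      from arg_cong[OF eq, of "\<lambda>z. z mod B"] B[OF *(1)] B[OF *(2)]
      have j: "Poly_Mapping.lookup m j = Poly_Mapping.lookup m' j" by simp
      have "B \<noteq> 0" by (simp add: B_def)
      with eq j have "(\<Sum>i\<in>I. w i * Poly_Mapping.lookup m i) = (\<Sum>i\<in>I. w i * Poly_Mapping.lookup m' i)"
        by simp
      with w[OF *(1,2)] j *(3) show "Poly_Mapping.lookup m i = Poly_Mapping.lookup m' i" by blast
    qed
  qed auto
  from this[of UNIV] obtain w :: "'n \<Rightarrow> nat" where w: "\<forall>m\<in>S. \<forall>m'\<in>S.
      (\<Sum>i\<in>UNIV. w i * Poly_Mapping.lookup m i) = (\<Sum>i\<in>UNIV. w i * Poly_Mapping.lookup m' i)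
      \<longrightarrow> (\<forall>i\<in>UNIV. Poly_Mapping.lookup m i = Poly_Mapping.lookup m' i)" by blast
  show thesis
    by (rule that[of w], rule inj_onI, rule poly_mapping_eqI) (use w in blast)
qed

lemma coeff_poly_at_separating:
  assumes "inj_on (\<lambda>m. \<Sum>i\<in>UNIV. w i * Poly_Mapping.lookup m i) (Poly_Mapping.keys P)"
    and "m \<in> Poly_Mapping.keys P"
  shows "coeff (poly_at P (\<lambda>i. monom 1 (w i))) (\<Sum>i\<in>UNIV. w i * Poly_Mapping.lookup m i)
           = Poly_Mapping.lookup P m"
proof -
  have "coeff (poly_at P (\<lambda>i. monom 1 (w i))) (\<Sum>i\<in>UNIV. w i * Poly_Mapping.lookup m i)
      = (\<Sum>m'\<in>Poly_Mapping.keys P. if m' = m then Poly_Mapping.lookup P m' else 0)"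
    unfolding poly_at_monom coeff_sum
    by (intro sum.cong) (use assms in \<open>auto simp: inj_on_def\<close>)
  thus ?thesis using assms(2) by simp
qed

text \<open>Kronecker's substitution yields a nonzero polynomial in one variable; a positive integer
  \<open>k\<close> that is not a root gives the point with coordinates
  \<open>k ^ w i\<close>.\<close>

lemma exists_nat_point_poly_fun_nonzero:
  fixes P :: "('n::finite, 'a::{idom, ring_char_0}) mpoly"
  assumes "P \<noteq> 0"
  obtains u :: "'n \<Rightarrow> nat" where "\<And>i. u i > 0" "poly_fun P (\<chi> i. of_nat (u i)) \<noteq> 0"
proof -
  obtain w :: "'n \<Rightarrow> nat"
    where w: "inj_on (\<lambda>m. \<Sum>i\<in>UNIV. w i * Poly_Mapping.lookup m i) (Poly_Mapping.keys P)"
    by (rule exists_separating_weights[OF finite_keys])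
  obtain m where m: "m \<in> Poly_Mapping.keys P" using assms by (metis ex_in_conv keys_eq_empty)
  have "poly_at P (\<lambda>i. monom 1 (w i)) \<noteq> 0"
    using coeff_poly_at_separating[OF w m] m by (auto simp: in_keys_iff)
  then obtain k :: nat where "k > 0" "poly (poly_at P (\<lambda>i. monom 1 (w i))) (of_nat k) \<noteq> 0"
    using poly_eqI_of_nat[of "poly_at P (\<lambda>i. monom 1 (w i))" 0] by auto
  thus thesis by (intro that[of "\<lambda>i. k ^ w i"]) (simp_all add: poly_poly_at poly_monom)
qed

lemma mpoly_eqI_poly_fun:
  fixes P T :: "('n::finite, 'a::{idom, ring_char_0}) mpoly"
  assumes "\<And>x. poly_fun P x = poly_fun T x"
  shows "P = T"
proof (rule ccontr)
  assume "P \<noteq> T"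
  hence "P - T \<noteq> 0" by simp
  from exists_nat_point_poly_fun_nonzero[OF this] show False
    by (metis assms poly_fun_diff right_minus_eq)
qed

section \<open>Uniqueness of commuting polynomials\<close>

text \<open>Let \<open>D = P - T\<close> have degree \<open>q\<close>; then \<open>q < p\<close>.
  Along a line, \<open>g(P) - g(T) = D(g, ..., g)\<close> has degree at most \<open>q * N\<close>
  with \<open>N = degree g\<close>, but at least \<open>q + (N - 1) * p\<close> by the mean value
  estimate, so \<open>p <= q\<close>. Leading forms are compared at positive \<open>u\<close>, where
  monomials do not vanish.\<close>

lemma commuting_mpoly_unique:
  fixes P T :: "('n::finite, 'a::{idom, ring_char_0}) mpoly"
  defines "line \<equiv> \<lambda>u i. monom (of_nat (u i) :: 'a) 1"
  assumes g: "degree g \<ge> 2"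
    and P: "\<And>y :: 'n \<Rightarrow> nat. poly g (poly_fun P (\<chi> i. of_nat (y i))) = poly_fun P (\<chi> i. poly g (of_nat (y i)))"
    and T: "\<And>y :: 'n \<Rightarrow> nat. poly g (poly_fun T (\<chi> i. of_nat (y i))) = poly_fun T (\<chi> i. poly g (of_nat (y i)))"
    and top: "\<And>u :: 'n \<Rightarrow> nat. (\<And>i. u i > 0) \<Longrightarrow> degree (poly_at P (line u)) = p"
      "\<And>u :: 'n \<Rightarrow> nat. (\<And>i. u i > 0) \<Longrightarrow> degree (poly_at T (line u)) = p"
      "\<And>u :: 'n \<Rightarrow> nat. (\<And>i. u i > 0) \<Longrightarrow> coeff (poly_at P (line u)) p = coeff (poly_at T (line u)) p"
    and p: "p > 0"
  shows "P = T"
proof (rule ccontr)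
  assume "P \<noteq> T"
  define D where "D = P - T"
  define q where "q = total_degree D"
  define N where "N = degree g"
  have "hom_part q D \<noteq> 0" using \<open>P \<noteq> T\<close> unfolding q_def
    by (intro hom_part_total_degree_nonzero) (simp add: D_def)
  \<comment> \<open>The leading form of \<open>D\<close> does not vanish at \<open>u\<close>, so
    \<open>D\<close> keeps its degree on the line through \<open>u\<close>.\<close>
  then obtain u :: "'n \<Rightarrow> nat"
    where u: "\<And>i. u i > 0" "poly_fun (hom_part q D) (\<chi> i. of_nat (u i)) \<noteq> 0"
    using exists_nat_point_poly_fun_nonzero by blast
  define A where "A = poly_at P (line u)"
  define B where "B = poly_at T (line u)"
  have AB: "A - B = poly_at D (line u)"
    by (rule poly_eqI_of_nat) (simp add: A_def B_def D_def poly_poly_at poly_fun_diff)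
  have "degree (poly_at D (line u)) \<le> q * 1"
    by (rule poly_at_degree_bound) (auto simp: line_def q_def degree_monom_le)
  moreover have nz: "coeff (poly_at D (line u)) q \<noteq> 0"
    using u(2) unfolding line_def coeff_poly_at_line .
  ultimately have deg: "degree (A - B) = q"
    unfolding AB using le_degree[OF nz] by simp
  have ne: "A \<noteq> B" using nz unfolding AB[symmetric] by auto
  have tops: "degree A = p" "degree B = p" "lead_coeff A = lead_coeff B"
    using top[OF u(1)] by (simp_all add: A_def B_def)
  have "q < p" using degree_diff_less_of_lead_coeff_eq[OF tops] p deg by simp
  have "pcompose g A - pcompose g B = poly_at D (\<lambda>i. pcompose g (line u i))"
  proof (rule poly_eqI_of_nat)
    fix k :: nat
    show "poly (pcompose g A - pcompose g B) (of_nat k)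
        = poly (poly_at D (\<lambda>i. pcompose g (line u i))) (of_nat k)"
      using P[of "\<lambda>i. u i * k"] T[of "\<lambda>i. u i * k"]
      by (simp add: A_def B_def D_def line_def poly_pcompose poly_poly_at poly_fun_diff poly_monom)
  qed
  hence "degree (pcompose g A - pcompose g B) \<le> q * N"
    using poly_at_degree_bound(1)[of "\<lambda>i. pcompose g (line u i)" N D q] g
      degree_pcompose_bound[of g N _ 1] by (simp add: N_def q_def line_def degree_monom_le)
  moreover have "q + (N - 1) * p \<le> degree (pcompose g A - pcompose g B)"
    using degree_pcompose_diff_ge[OF tops ne, of g] g deg by (simp add: N_def)
  moreover have "q * N = q + (N - 1) * q" using g by (cases N) (simp_all add: N_def)
  ultimately have "(N - 1) * p \<le> (N - 1) * q" by linarith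
  hence "p \<le> q" using g by (simp add: N_def)
  with \<open>q < p\<close> show False by simp
qed

section \<open>Bisymmetric polynomial functions\<close>

text \<open>Kronecker's substitution turns the identity between the leading forms into an equation
  in one variable that only monomials satisfy; the separating weights carry this back to
  \<open>Q\<close>.\<close>

lemma hom_part_is_monomial:
  fixes P :: "('n::finite, 'a::{idom, ring_char_0}) mpoly"
  assumes bis: "\<And>X :: 'n \<Rightarrow> 'n \<Rightarrow> nat.
      poly_fun P (\<chi> i. poly_fun P (\<chi> j. of_nat (X i j)))
        = poly_fun P (\<chi> i. poly_fun P (\<chi> j. of_nat (X j i)))"
    and p: "total_degree P = p" "p \<ge> 2"
  shows "is_monomial (hom_part p P)"
proof -
  define Q where "Q = hom_part p P"
  have "P \<noteq> 0" using p by (auto simp: total_degree_def)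
  hence "Q \<noteq> 0" using hom_part_total_degree_nonzero p(1) by (auto simp: Q_def)
  then obtain v :: "'n \<Rightarrow> nat" where v: "poly_fun Q (\<chi> i. of_nat (v i)) \<noteq> 0"
    using exists_nat_point_poly_fun_nonzero by blast
  define C where "C = poly_fun Q (\<chi> i. of_nat (v i))"
  define C' where "C' = poly_fun Q (\<chi> i. of_nat (v i) ^ p)"
  have key: "C ^ p * poly_fun Q (\<chi> i. of_nat (y i) ^ p) = C' * poly_fun Q (\<chi> i. of_nat (y i)) ^ p"
    for y :: "'n \<Rightarrow> nat"
  proof -
    define Y where "Y = poly_fun Q (\<chi> i. of_nat (y i))"
    \<comment> \<open>\<open>F i\<close> belongs to a row of the matrix \<open>y i * v j * t\<close>
      and \<open>G j\<close> to a column. By homogeneity their coefficients at \<open>p\<close> are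
      \<open>C * y i ^ p\<close> and \<open>Y * v j ^ p\<close>.\<close>
    define F where "F i = poly_at P (\<lambda>j. monom (of_nat (y i * v j)) 1)" for i
    define G where "G j = poly_at P (\<lambda>i. monom (of_nat (y i * v j)) 1)" for j
    have deg: "degree (F i) \<le> p" "degree (G i) \<le> p" for i
      using poly_at_degree_bound(1)[of "\<lambda>j. monom (of_nat (y i * v j)) 1" 1 P p]
        poly_at_degree_bound(1)[of "\<lambda>j. monom (of_nat (y j * v i)) 1" 1 P p] p
      by (simp_all add: F_def G_def degree_monom_le)
    have "coeff (F i) p = C * of_nat (y i) ^ p" for i
      unfolding F_def coeff_poly_at_line using poly_fun_hom_part_scale[of p P "of_nat (y i)" "\<lambda>j. of_nat (v j)"]
      by (simp add: C_def Q_def mult.commute)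
    hence F: "coeff (poly_at P F) (p * p) = C ^ p * poly_fun Q (\<chi> i. of_nat (y i) ^ p)"
      using poly_at_degree_bound(2)[of F p P p] deg p poly_fun_hom_part_scale[of p P C]
      by (simp add: Q_def)
    have "coeff (G j) p = Y * of_nat (v j) ^ p" for j
      unfolding G_def coeff_poly_at_line using poly_fun_hom_part_scale[of p P "of_nat (v j)" "\<lambda>i. of_nat (y i)"]
      by (simp add: Y_def Q_def mult.commute)
    hence G: "coeff (poly_at P G) (p * p) = Y ^ p * C'"
      using poly_at_degree_bound(2)[of G p P p] deg p poly_fun_hom_part_scale[of p P Y]
      by (simp add: Q_def C'_def)
    have "poly_at P F = poly_at P G"
    proof (rule poly_eqI_of_nat)
      fix k :: nat
      show "poly (poly_at P F) (of_nat k) = poly (poly_at P G) (of_nat k)"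
        using bis[of "\<lambda>i j. y i * v j * k"] by (simp add: F_def G_def poly_poly_at poly_monom)
    qed
    with F G show ?thesis by (simp add: Y_def mult.commute)
  qed
  obtain w :: "'n \<Rightarrow> nat"
    where w: "inj_on (\<lambda>m. \<Sum>i\<in>UNIV. w i * Poly_Mapping.lookup m i) (Poly_Mapping.keys Q)"
    by (rule exists_separating_weights[OF finite_keys])
  define f where "f = poly_at Q (\<lambda>i. monom 1 (w i))"
  have "smult (C ^ p) (pcompose f (monom 1 p)) = smult C' (f ^ p)"
  proof (rule poly_eqI_of_nat)
    fix k :: nat
    show "poly (smult (C ^ p) (pcompose f (monom 1 p))) (of_nat k) = poly (smult C' (f ^ p)) (of_nat k)"
      using key[of "\<lambda>i. k ^ w i"]
      by (simp add: f_def poly_pcompose poly_poly_at poly_monom mult.commute flip: power_mult)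
  qed
  hence f: "f = monom (lead_coeff f) (degree f)"
    using v p(2) by (intro power_substitution_imp_monom[of p "C ^ p"]) (simp_all add: C_def)
  have deg: "(\<Sum>i\<in>UNIV. w i * Poly_Mapping.lookup m i) = degree f" if "m \<in> Poly_Mapping.keys Q" for m
  proof (rule ccontr)
    assume *: "(\<Sum>i\<in>UNIV. w i * Poly_Mapping.lookup m i) \<noteq> degree f"
    have "coeff f (\<Sum>i\<in>UNIV. w i * Poly_Mapping.lookup m i) \<noteq> 0"
      using coeff_poly_at_separating[OF w that] that by (simp add: f_def in_keys_iff)
    thus False using * by (subst (asm) f) simp
  qed
  obtain m where m: "m \<in> Poly_Mapping.keys Q"
    using \<open>Q \<noteq> 0\<close> by (metis ex_in_conv keys_eq_empty)
  have "m' = m" if "m' \<in> Poly_Mapping.keys Q" for m'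
    using inj_onD[OF w _ that m] deg[OF that] deg[OF m] by simp
  hence "Q = Poly_Mapping.single m (Poly_Mapping.lookup Q m)"
    by (intro poly_mapping_eqI) (auto simp: lookup_single when_def in_keys_iff)
  with m show ?thesis unfolding Q_def[symmetric] is_monomial_def by (auto simp: in_keys_iff)
qed

section \<open>The two possible shapes\<close>

lemma poly_fun_two_values:
  "poly_fun P (\<chi> i. if i = k then x else y) = (\<Sum>m\<in>Poly_Mapping.keys P.
     Poly_Mapping.lookup P m * x ^ Poly_Mapping.lookup m k * y ^ (mdeg m - Poly_Mapping.lookup m k))"
proof -
  have "(\<Prod>i\<in>UNIV. (if i = k then x else y) ^ Poly_Mapping.lookup m i)
      = x ^ Poly_Mapping.lookup m k * y ^ (mdeg m - Poly_Mapping.lookup m k)" for m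
  proof -
    have "mdeg m - Poly_Mapping.lookup m k = (\<Sum>i\<in>UNIV - {k}. Poly_Mapping.lookup m i)"
      unfolding mdeg_def by (subst sum.remove[of UNIV k]) auto
    moreover have "(\<Prod>i\<in>UNIV. (if i = k then x else y) ^ Poly_Mapping.lookup m i)
        = x ^ Poly_Mapping.lookup m k * (\<Prod>i\<in>UNIV - {k}. y ^ Poly_Mapping.lookup m i)"
      by (subst prod.remove[of UNIV k]) (auto intro!: prod.cong)
    ultimately show ?thesis by (simp add: power_sum)
  qed
  thus ?thesis by (simp add: poly_fun_def mult.assoc)
qed

text \<open>Each case exhibits a polynomial that commutes with the diagonal \<open>g\<close> and has
  the leading form of \<open>P\<close>, hence equals \<open>P\<close>. The coefficients lie in a
  field since \<open>\<beta>\<close> arises as a quotient.\<close>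

lemma bisymmetric_cases:
  fixes P :: "('n::finite, 'a::field_char_0) mpoly"
  assumes bis: "\<And>X :: 'n \<Rightarrow> 'n \<Rightarrow> nat.
      poly_fun P (\<chi> i. poly_fun P (\<chi> j. of_nat (X i j)))
        = poly_fun P (\<chi> i. poly_fun P (\<chi> j. of_nat (X j i)))"
    and p: "total_degree P = p" "p \<ge> 2"
    and top: "hom_part p P = Poly_Mapping.single \<gamma> c" "c \<noteq> 0"
  obtains (univariate) i g where "\<And>x. poly_fun P x = poly g (x $ i)"
    | (monomial) \<beta> where
      "\<And>x. poly_fun P x = c * (\<Prod>i\<in>UNIV. (x $ i + \<beta>) ^ Poly_Mapping.lookup \<gamma> i) - \<beta>"
      "poly_fun (hom_part (p - 1) P) 1 = of_nat p * c * \<beta>"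
proof -
  define g where "g = poly_at P (\<lambda>_. monom 1 1)"
  define line where "line u i = monom (of_nat (u i) :: 'a) 1" for u :: "'n \<Rightarrow> nat" and i
  have "\<gamma> \<in> Poly_Mapping.keys (hom_part p P)" using top by simp
  hence \<gamma>: "mdeg \<gamma> = p" by (simp add: keys_hom_part)
  have g_fun: "poly g t = poly_fun P (\<chi> i. t)" for t
    by (simp add: g_def poly_poly_at poly_monom)
  have coeff_g: "coeff g k = poly_fun (hom_part k P) 1" for k
    unfolding g_def coeff_poly_at_line by (simp add: one_vec_def)
  have cg: "coeff g p = c" by (simp add: coeff_g top poly_fun_single)
  have "degree g \<le> p"
    using poly_at_degree_bound(1)[of "\<lambda>_. monom 1 1" 1 P p] p by (simp add: g_def degree_monom_le)
  hence deg_g: "degree g = p" using cg top(2) by (intro antisym le_degree) auto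
  have lead_g: "lead_coeff g = c" using cg deg_g by simp
  \<comment> \<open>In the matrix with constant rows \<open>y i\<close>, one order of evaluation
    gives \<open>P\<close> at the values \<open>g(y i)\<close>, the other gives \<open>g\<close> at
    \<open>P(y)\<close>.\<close>
  have comm: "poly g (poly_fun P (\<chi> i. of_nat (y i))) = poly_fun P (\<chi> i. poly g (of_nat (y i)))"
    for y :: "'n \<Rightarrow> nat"
    using bis[of "\<lambda>i j. y i"] by (simp add: g_fun)
  have topP: "degree (poly_at P (line u)) = p"
      "coeff (poly_at P (line u)) p = c * (\<Prod>i\<in>UNIV. of_nat (u i) ^ Poly_Mapping.lookup \<gamma> i)"
    if "\<And>i. u i > 0" for u
  proof -
    show *: "coeff (poly_at P (line u)) p = c * (\<Prod>i\<in>UNIV. of_nat (u i) ^ Poly_Mapping.lookup \<gamma> i)"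
      unfolding line_def coeff_poly_at_line by (simp add: top poly_fun_single)
    have "degree (poly_at P (line u)) \<le> p"
      using poly_at_degree_bound(1)[of "line u" 1 P p] p by (simp add: line_def degree_monom_le)
    moreover have "coeff (poly_at P (line u)) p \<noteq> 0"
      using that top(2) unfolding * by (simp add: less_imp_neq)
    ultimately show "degree (poly_at P (line u)) = p" by (intro antisym le_degree)
  qed
  have unique: "P = T" if
    commT: "\<And>y :: 'n \<Rightarrow> nat. poly g (poly_fun T (\<chi> i. of_nat (y i))) = poly_fun T (\<chi> i. poly g (of_nat (y i)))"
    and degT: "\<And>u :: 'n \<Rightarrow> nat. degree (poly_at T (line u)) \<le> p"
    and coeffT: "\<And>u :: 'n \<Rightarrow> nat. coeff (poly_at T (line u)) p
         = c * (\<Prod>i\<in>UNIV. of_nat (u i) ^ Poly_Mapping.lookup \<gamma> i)" for T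
  proof (rule commuting_mpoly_unique[of g P T p])
    fix u :: "'n \<Rightarrow> nat" assume u: "\<And>i. u i > 0"
    show "degree (poly_at P (\<lambda>i. monom (of_nat (u i)) 1)) = p"
      using topP(1)[OF u] by (simp add: line_def[abs_def])
    show eq: "coeff (poly_at P (\<lambda>i. monom (of_nat (u i)) 1)) p
        = coeff (poly_at T (\<lambda>i. monom (of_nat (u i)) 1)) p"
      using topP(2)[OF u] coeffT[of u] by (simp add: line_def[abs_def])
    have "coeff (poly_at T (line u)) p \<noteq> 0"
      using u top(2) unfolding coeffT by (simp add: less_imp_neq)
    with degT[of u] have "degree (poly_at T (line u)) = p" by (intro antisym le_degree)
    thus "degree (poly_at T (\<lambda>i. monom (of_nat (u i)) 1)) = p" by (simp add: line_def[abs_def])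
  qed (use comm commT p deg_g in auto)
  show thesis
  proof (cases "\<exists>k. Poly_Mapping.lookup \<gamma> k = p")
    case True
    then obtain k where k: "Poly_Mapping.lookup \<gamma> k = p" by blast
    have "(\<Sum>i\<in>UNIV - {k}. Poly_Mapping.lookup \<gamma> i) = 0"
      using \<gamma> k unfolding mdeg_def by (subst (asm) sum.remove[of UNIV k]) auto
    hence "(\<Prod>i\<in>UNIV - {k}. x i ^ Poly_Mapping.lookup \<gamma> i) = 1" for x :: "'n \<Rightarrow> 'a"
      by (intro prod.neutral) auto
    hence mono: "(\<Prod>i\<in>UNIV. x i ^ Poly_Mapping.lookup \<gamma> i) = x k ^ p" for x :: "'n \<Rightarrow> 'a"
      by (subst prod.remove[of UNIV k]) (auto simp: k)
    \<comment> \<open>\<open>T\<close> is \<open>g\<close> in the variable \<open>k\<close>. It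
      commutes with \<open>g\<close> trivially, and its leading form is \<open>c\<close> times the
      \<open>p\<close>-th power of that variable, as for \<open>P\<close>.\<close>
    define T where "T = (\<Sum>j\<le>p. const (coeff g j) * (vars $ k) ^ j :: ('n, 'a) mpoly)"
    have T: "poly_fun T x = poly g (x $ k)" for x
      by (simp add: T_def poly_fun_sum poly_fun_mult poly_fun_power poly_altdef deg_g)
    have line_T: "poly_at T (line u) = pcompose g (line u k)" for u
      by (rule poly_eqI_of_nat) (simp add: poly_poly_at T poly_pcompose)
    have "P = T"
    proof (rule unique)
      fix u :: "'n \<Rightarrow> nat"
      show "degree (poly_at T (line u)) \<le> p"
        using degree_pcompose_bound[of g p "line u k" 1] deg_g
        by (simp add: line_T line_def degree_monom_le)
      show "coeff (poly_at T (line u)) p = c * (\<Prod>i\<in>UNIV. of_nat (u i) ^ Poly_Mapping.lookup \<gamma> i)"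
        using coeff_pcompose_degree_bound[of g p "line u k" 1] deg_g cg
        by (simp add: line_T line_def degree_monom_le mono)
    qed (simp add: T)
    with T show thesis by (intro univariate) auto
  next
    case False
    have "\<exists>k. Poly_Mapping.lookup \<gamma> k \<noteq> 0"
    proof (rule ccontr)
      assume "\<not> ?thesis"
      hence "mdeg \<gamma> = 0" by (simp add: mdeg_def)
      with \<gamma> p show False by simp
    qed
    then obtain k where k: "Poly_Mapping.lookup \<gamma> k > 0" by auto
    have le_mdeg: "Poly_Mapping.lookup m k \<le> mdeg m" for m
      unfolding mdeg_def by (rule member_le_sum) auto
    have k_less: "Poly_Mapping.lookup \<gamma> k < p"
      using False le_mdeg[of \<gamma>] \<gamma> by (metis le_neq_implies_less)
    \<comment> \<open>\<open>H\<close> is \<open>P\<close> with \<open>x\<close> in place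
      \<open>k\<close> and \<open>y\<close> elsewhere, as a polynomial in \<open>y\<close> over the
      polynomials in \<open>x\<close>. The exponent of \<open>k\<close> in \<open>\<gamma>\<close>
      lies strictly between 0 and \<open>p\<close>, so the leading monomial involves both.\<close>
    define H where "H = (\<Sum>m\<in>Poly_Mapping.keys P.
      monom (monom (Poly_Mapping.lookup P m) (Poly_Mapping.lookup m k)) (mdeg m - Poly_Mapping.lookup m k))"
    define A where "A x = map_poly (\<lambda>h. poly h x) H" for x
    have A: "poly (A x) y = poly_fun P (\<chi> i. if i = k then x else y)" for x y
    proof -
      have "A x = (\<Sum>m\<in>Poly_Mapping.keys P.
          monom (Poly_Mapping.lookup P m * x ^ Poly_Mapping.lookup m k) (mdeg m - Poly_Mapping.lookup m k))"
        by (rule poly_eqI)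
           (auto simp: A_def H_def coeff_map_poly coeff_sum poly_sum poly_monom intro!: sum.cong)
      thus ?thesis by (simp add: poly_fun_two_values poly_sum poly_monom)
    qed
    have commH: "pcompose g (A (of_nat x)) = pcompose (A (poly g (of_nat x))) g" for x :: nat
    proof (rule poly_eqI_of_nat)
      fix y :: nat
      have "(\<chi> i. of_nat (if i = k then x else y)) = (\<chi> i. if i = k then of_nat x else (of_nat y :: 'a))"
        by (simp add: vec_eq_iff)
      moreover have "(\<chi> i. poly g (of_nat (if i = k then x else y)))
          = (\<chi> i. if i = k then poly g (of_nat x) else poly g (of_nat y))"
        by (simp add: vec_eq_iff)
      ultimately show "poly (pcompose g (A (of_nat x))) (of_nat y)
          = poly (pcompose (A (poly g (of_nat x))) g) (of_nat y)"
        using comm[of "\<lambda>i. if i = k then x else y"] by (simp add: poly_pcompose A)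
    qed
    \<comment> \<open>Only terms of degree \<open>p\<close> contribute to this coefficient, and
      \<open>\<gamma>\<close> is the only one.\<close>
    have "coeff (coeff H (p - Poly_Mapping.lookup \<gamma> k)) (Poly_Mapping.lookup \<gamma> k)
        = (\<Sum>m\<in>Poly_Mapping.keys P. if m = \<gamma> then c else 0)"
      unfolding H_def coeff_sum
    proof (rule sum.cong[OF refl])
      fix m assume m: "m \<in> Poly_Mapping.keys P"
      have eq: "Poly_Mapping.lookup (Poly_Mapping.single \<gamma> c) m
          = (if mdeg m = p then Poly_Mapping.lookup P m else 0)"
        unfolding top(1)[symmetric] lookup_hom_part ..
      show "coeff (coeff (monom (monom (Poly_Mapping.lookup P m) (Poly_Mapping.lookup m k))
            (mdeg m - Poly_Mapping.lookup m k)) (p - Poly_Mapping.lookup \<gamma> k)) (Poly_Mapping.lookup \<gamma> k)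
          = (if m = \<gamma> then c else 0)"
      proof (cases "m = \<gamma>")
        case True
        thus ?thesis using eq \<gamma> by simp
      next
        case False
        hence "mdeg m \<noteq> p" using eq m by (auto simp: lookup_single when_def in_keys_iff)
        hence "mdeg m - Poly_Mapping.lookup m k = p - Poly_Mapping.lookup \<gamma> k
            \<longrightarrow> Poly_Mapping.lookup m k \<noteq> Poly_Mapping.lookup \<gamma> k"
          using le_mdeg[of m] k_less by auto
        thus ?thesis using False by auto
      qed
    qed
    also have "\<dots> = c"
      using top(2) arg_cong[OF top(1), of "\<lambda>Q. Poly_Mapping.lookup Q \<gamma>"]
      by (simp add: lookup_hom_part \<gamma> in_keys_iff)
    finally have nz: "coeff (coeff H (p - Poly_Mapping.lookup \<gamma> k)) (Poly_Mapping.lookup \<gamma> k) \<noteq> 0"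
      using top(2) by simp
    hence "degree (coeff H (p - Poly_Mapping.lookup \<gamma> k)) > 0"
      using k le_degree by fastforce
    moreover from this have "degree H > 0"
      using k_less le_degree[of H "p - Poly_Mapping.lookup \<gamma> k"] by fastforce
    ultimately have h: "degree (lead_coeff H) > 0"
      "smult (lead_coeff g ^ degree H) (pcompose (lead_coeff H) g) = smult (lead_coeff g) (lead_coeff H ^ p)"
      using lead_coeff_of_semiconjugate[OF deg_g p(2), of H] commH unfolding A_def by blast+
    from arg_cong[OF h(2), of "smult (inverse (lead_coeff g ^ degree H))"]
    have "pcompose (lead_coeff H) g
        = smult (inverse (lead_coeff g ^ degree H) * lead_coeff g) (lead_coeff H ^ p)"
      using top(2) by (simp add: lead_g)
    then obtain \<rho> where \<rho>: "g = smult (lead_coeff g) ([:-\<rho>, 1:] ^ p) + [:\<rho>:]"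
      by (rule pcompose_eq_power_imp_shifted_power[OF h(1) deg_g p(2)])
    define \<beta> where "\<beta> = -\<rho>"
    have g: "g = smult c ([:\<beta>, 1:] ^ p) + [:-\<beta>:]" using \<rho> by (simp only: lead_g \<beta>_def minus_minus)
    have poly_g: "poly g z = c * (z + \<beta>) ^ p - \<beta>" for z by (subst g) (simp add: add.commute)
    define T where "T = const c * (\<Prod>i\<in>UNIV. (vars $ i + const \<beta>) ^ Poly_Mapping.lookup \<gamma> i)
      - (const \<beta> :: ('n, 'a) mpoly)"
    have T: "poly_fun T x = c * (\<Prod>i\<in>UNIV. (x $ i + \<beta>) ^ Poly_Mapping.lookup \<gamma> i) - \<beta>" for x
      by (simp add: T_def poly_fun_diff poly_fun_mult poly_fun_prod poly_fun_power poly_fun_add)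
    define L where "L u = (\<Prod>i\<in>UNIV. [:\<beta>, of_nat (u i):] ^ Poly_Mapping.lookup \<gamma> i)" for u :: "'n \<Rightarrow> nat"
    have line_T: "poly_at T (line u) = smult c (L u) - [:\<beta>:]" for u
      by (rule poly_eqI_of_nat)
         (simp add: poly_poly_at T line_def L_def poly_monom poly_prod add.commute mult.commute)
    have L: "degree (L u) \<le> p" "coeff (L u) p = (\<Prod>i\<in>UNIV. of_nat (u i) ^ Poly_Mapping.lookup \<gamma> i)" for u
      using coeff_prod_degree_bound[of UNIV "\<lambda>i. [:\<beta>, of_nat (u i):] ^ Poly_Mapping.lookup \<gamma> i"
          "Poly_Mapping.lookup \<gamma>"] coeff_power_degree_bound[of "[:\<beta>, of_nat (u _):]" 1] \<gamma>
      by (simp_all add: L_def mdeg_def)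
    have "P = T"
    proof (rule unique)
      fix u :: "'n \<Rightarrow> nat"
      show "degree (poly_at T (line u)) \<le> p" unfolding line_T
        by (intro degree_diff_le order.trans[OF degree_smult_le L(1)]) simp
      show "coeff (poly_at T (line u)) p = c * (\<Prod>i\<in>UNIV. of_nat (u i) ^ Poly_Mapping.lookup \<gamma> i)"
        unfolding line_T using p(2) by (simp add: L coeff_pCons split: nat.splits)
    next
      fix y :: "'n \<Rightarrow> nat"
      \<comment> \<open>This compares \<open>T(g)\<close> with \<open>g(T)\<close>; the exponents in
        \<open>\<gamma>\<close> add up to \<open>p\<close>, which produces the factor
        \<open>c ^ p\<close>.\<close>
      have "(\<Prod>i\<in>UNIV. (c * (of_nat (y i) + \<beta>) ^ p) ^ Poly_Mapping.lookup \<gamma> i)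
          = c ^ p * (\<Prod>i\<in>UNIV. (of_nat (y i) + \<beta>) ^ Poly_Mapping.lookup \<gamma> i) ^ p"
      proof -
        have "(\<Prod>i\<in>UNIV. (c * (of_nat (y i) + \<beta>) ^ p) ^ Poly_Mapping.lookup \<gamma> i)
            = (\<Prod>i\<in>UNIV. c ^ Poly_Mapping.lookup \<gamma> i * ((of_nat (y i) + \<beta>) ^ Poly_Mapping.lookup \<gamma> i) ^ p)"
          by (simp add: power_mult_distrib mult.commute flip: power_mult)
        also have "\<dots> = (\<Prod>i\<in>UNIV. c ^ Poly_Mapping.lookup \<gamma> i)
            * (\<Prod>i\<in>UNIV. (of_nat (y i) + \<beta>) ^ Poly_Mapping.lookup \<gamma> i) ^ p"
          by (simp add: prod.distrib prod_power_distrib)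
        also have "(\<Prod>i\<in>UNIV. c ^ Poly_Mapping.lookup \<gamma> i) = c ^ p"
          unfolding \<gamma>[symmetric] mdeg_def power_sum ..
        finally show ?thesis .
      qed
      thus "poly g (poly_fun T (\<chi> i. of_nat (y i))) = poly_fun T (\<chi> i. poly g (of_nat (y i)))"
        by (simp add: T poly_g power_mult_distrib)
    qed
    have "poly_fun (hom_part (p - 1) P) 1 = coeff g (p - 1)" by (simp add: coeff_g)
    \<comment> \<open>Since \<open>p - 1 >= 1\<close>, the constant \<open>-\<beta>\<close> does not
      affect this coefficient.\<close>
    also have "\<dots> = of_nat p * c * \<beta>"
      using p(2) binomial_symmetric[of "p - 1" p]
      by (subst g) (simp add: coeff_linear_poly_power coeff_pCons split: nat.splits)
    finally show thesis using \<open>P = T\<close> T by (intro monomial[of \<beta>]) auto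
  qed
qed

section \<open>Shifted monomials and the equivalence\<close>

text \<open>The inner \<open>-\<beta>\<close> cancels against the outer shift. Up to constants, the
  product of \<open>(x_ij + \<beta>) ^ (e_i * e_j)\<close> over all \<open>i\<close> and
  \<open>j\<close> remains, whose exponents are symmetric.\<close>

lemma bisymmetric_shifted_monomial:
  fixes c \<beta> :: "'a::comm_ring_1" and e :: "'n::finite \<Rightarrow> nat"
  shows "bisymmetric (\<lambda>x :: 'a ^ 'n. c * (\<Prod>i\<in>UNIV. (x $ i + \<beta>) ^ e i) - \<beta>)"
proof -
  have "(\<Prod>i\<in>UNIV. (c * (\<Prod>j\<in>UNIV. (x $ i $ j + \<beta>) ^ e j)) ^ e i)
      = (\<Prod>i\<in>UNIV. (c * (\<Prod>j\<in>UNIV. (x $ j $ i + \<beta>) ^ e j)) ^ e i)" for x :: "'a ^ 'n ^ 'n"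
  proof -
    have "(\<Prod>i\<in>UNIV. \<Prod>j\<in>UNIV. ((x $ i $ j + \<beta>) ^ e j) ^ e i)
        = (\<Prod>i\<in>UNIV. \<Prod>j\<in>UNIV. ((x $ j $ i + \<beta>) ^ e j) ^ e i)"
      by (subst prod.swap) (simp add: mult.commute flip: power_mult)
    thus ?thesis by (simp add: power_mult_distrib prod.distrib prod_power_distrib)
  qed
  thus ?thesis by (simp add: bisymmetric_def)
qed

theorem mainTheorem2:
  fixes P :: "('n::finite, 'a::{idom, ring_char_0}) mpoly"
    and p :: nat
    and b :: "'a fract"
  assumes "\<not> univariate (poly_fun P)"
    and "total_degree P = p"
    and "p \<ge> 2"
    and "b = to_fract (poly_fun (hom_part (p - 1) P) 1) /
             (of_nat p * to_fract (poly_fun (hom_part p P) 1))"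
  shows "bisymmetric (poly_fun P) \<longleftrightarrow>
           is_monomial (hom_part p P) \<and>
           fract_poly_ext (hom_part p P) =
             poly_subst (fract_poly_ext P) (vars - const b *s 1) + const b"
proof -
  define Q where "Q = fract_poly_ext P"
  have lift: "to_fract (poly_fun R x) = poly_fun (fract_poly_ext R) (\<chi> i. to_fract (x $ i))"
    for R :: "('n, 'a) mpoly" and x
    by (rule poly_fun_fract_poly_ext[symmetric])
  have subst: "poly_fun (poly_subst Q (vars - const b *s 1) + const b) x
      = poly_fun Q (\<chi> i. x $ i - b) + b" for x
    by (simp add: poly_fun_add poly_fun_poly_subst poly_fun_diff)
  show ?thesis
  proof
    assume bis: "bisymmetric (poly_fun P)"
    \<comment> \<open>Bisymmetry is given at points of the domain only; at integer matrices it
      passes to the fraction field, which suffices for the classification.\<close>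
    have bisP: "poly_fun P (\<chi> i. poly_fun P (\<chi> j. of_nat (X i j)))
        = poly_fun P (\<chi> i. poly_fun P (\<chi> j. of_nat (X j i)))" for X :: "'n \<Rightarrow> 'n \<Rightarrow> nat"
      using bis[unfolded bisymmetric_def, rule_format, of "\<chi> i j. of_nat (X i j)"] by simp
    have bisQ: "poly_fun Q (\<chi> i. poly_fun Q (\<chi> j. of_nat (X i j)))
        = poly_fun Q (\<chi> i. poly_fun Q (\<chi> j. of_nat (X j i)))" for X :: "'n \<Rightarrow> 'n \<Rightarrow> nat"
      using arg_cong[OF bisP[of X], of to_fract] by (simp add: lift Q_def)
    have mono: "is_monomial (hom_part p P)"
      by (rule hom_part_is_monomial[OF bisP assms(2,3)])
    then obtain \<gamma> c where c: "hom_part p P = Poly_Mapping.single \<gamma> c" "c \<noteq> 0"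
      by (auto simp: is_monomial_def)
    have hQ: "hom_part p Q = fract_poly_ext (hom_part p P)"
      by (simp add: Q_def hom_part_fract_poly_ext)
    also have "\<dots> = Poly_Mapping.single \<gamma> (to_fract c)"
      by (rule poly_mapping_eqI) (simp add: c lookup_single when_def)
    finally have topQ: "hom_part p Q = Poly_Mapping.single \<gamma> (to_fract c)" .
    have degQ: "total_degree Q = p"
      using assms(2) by (simp add: total_degree_def Q_def)
    have nz: "to_fract c \<noteq> 0" using c(2) by simp
    have "fract_poly_ext (hom_part p P) = poly_subst Q (vars - const b *s 1) + const b"
    proof (cases rule: bisymmetric_cases[OF bisQ degQ assms(3) topQ nz, case_names univariate monomial])
      case (univariate k g)
      have "i = k" if dep: "depends_on (poly_fun P) i" for i
      proof (rule ccontr)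
        assume "i \<noteq> k"
        from dep obtain x y where xy: "\<forall>j. j \<noteq> i \<longrightarrow> x $ j = y $ j" "poly_fun P x \<noteq> poly_fun P y"
          unfolding depends_on_def by blast
        have "to_fract (poly_fun P x) = to_fract (poly_fun P y)"
          using xy(1) \<open>i \<noteq> k\<close> by (simp only: lift univariate[unfolded Q_def]) auto
        with xy(2) show False by simp
      qed
      hence "{i. depends_on (poly_fun P) i} \<subseteq> {k}" by blast
      hence "card {i. depends_on (poly_fun P) i} \<le> card {k}" by (intro card_mono) auto
      with assms(1) show ?thesis by (simp add: univariate_def)
    next
      case (monomial \<beta>)
      \<comment> \<open>\<open>P_p\<close> takes the value \<open>c\<close> at the all-ones vector,
        so \<open>b\<close> is the quotient of \<open>p * c * \<beta>\<close> by
        \<open>p * c\<close>.\<close>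
      have "b = poly_fun (hom_part (p - 1) Q) 1 / (of_nat p * to_fract c)"
        unfolding assms(4) lift hQ[symmetric] topQ
        by (simp add: Q_def hom_part_fract_poly_ext one_vec_def poly_fun_single)
      hence b: "b = \<beta>" using monomial(2) assms(3) c(2) by (simp add: field_simps)
      show ?thesis
        by (rule mpoly_eqI_poly_fun)
           (simp add: subst monomial(1) topQ poly_fun_single flip: hQ b)
    qed
    with mono show "is_monomial (hom_part p P) \<and> fract_poly_ext (hom_part p P) =
        poly_subst (fract_poly_ext P) (vars - const b *s 1) + const b"
      by (simp add: Q_def)
  next
    assume *: "is_monomial (hom_part p P) \<and> fract_poly_ext (hom_part p P) =
        poly_subst (fract_poly_ext P) (vars - const b *s 1) + const b"
    then obtain \<gamma> c where c: "hom_part p P = Poly_Mapping.single \<gamma> c"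
      by (auto simp: is_monomial_def)
    have "fract_poly_ext (hom_part p P) = Poly_Mapping.single \<gamma> (to_fract c)"
      by (rule poly_mapping_eqI) (simp add: c lookup_single when_def)
    with * have eq: "poly_subst Q (vars - const b *s 1) + const b = Poly_Mapping.single \<gamma> (to_fract c)"
      by (simp add: Q_def)
    have "poly_fun Q (\<chi> i. x $ i - b) + b
        = to_fract c * (\<Prod>i\<in>UNIV. (x $ i) ^ Poly_Mapping.lookup \<gamma> i)" for x
      using subst[of x] unfolding eq by (simp add: poly_fun_single)
    \<comment> \<open>Translating by \<open>b\<close> solves the identity for \<open>Q\<close> and
      shows that it is a shifted monomial; injectivity of \<open>to_fract\<close> then leads back to
      \<open>P\<close>.\<close>
    from this[of "\<chi> i. x $ i + b" for x]
    have "poly_fun Q x = to_fract c * (\<Prod>i\<in>UNIV. (x $ i + b) ^ Poly_Mapping.lookup \<gamma> i) - b" for x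
      by (simp add: eq_diff_eq)
    hence bisQ: "bisymmetric (poly_fun Q)"
      using bisymmetric_shifted_monomial[of "to_fract c" b "Poly_Mapping.lookup \<gamma>"] by presburger
    have "poly_fun Q (\<chi> i. poly_fun Q (\<chi> j. to_fract (x $ i $ j)))
        = poly_fun Q (\<chi> i. poly_fun Q (\<chi> j. to_fract (x $ j $ i)))" for x :: "'a ^ 'n ^ 'n"
      using bisQ[unfolded bisymmetric_def, rule_format, of "\<chi> i j. to_fract (x $ i $ j)"] by simp
    hence "to_fract (poly_fun P (\<chi> i. poly_fun P (\<chi> j. x $ i $ j)))
        = to_fract (poly_fun P (\<chi> i. poly_fun P (\<chi> j. x $ j $ i)))" for x :: "'a ^ 'n ^ 'n"
      by (simp add: lift Q_def)
    thus "bisymmetric (poly_fun P)" by (simp add: bisymmetric_def)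
  qed
qed

end
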